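(* Let $\mathcal G$ be a graph of group actions and let $\Sigma$ be a scaffolding for $\mathcal G$. Suppose the universal group $\mathcal U(\mathcal G)$ is defined with respect to $\Sigma$ and some legal colouring $p$. Then every locally-$\mathcal G$ subgroup of $\mathrm{Aut}_{\mathrm{sc}}(\Sigma)$ is conjugate (in $\mathrm{Aut}_{\mathrm{sc}}(\Sigma)$) to some subgroup of $\mathcal U(\mathcal G)$.
   Context: **Graphs.** A graph $\Gamma$ has a vertex set $V\Gamma$, an arc set $A\Gamma$, maps $o,t\colon A\Gamma\to V\Gamma$ (origin, terminus) and an involution $a\mapsto\bar a$ on arcs with $o(a)=t(\bar a)$; an arc with $\bar a=a$ is called self-reverse (loops with $\bar a\ne a$ are also allowed). Graph morphisms preserve $o$, $t$ and reversal. A tree is a connected graph without loops and without two arcs having the same origin and the same terminus, which has no simple cycles of length $\ge 3$. **Group actions.** A permutation group action $(G,X)$ is a faithful action of a group $G$ on a non-empty set $X$. For $Y\subseteq X$, $G^Y$ is the permutation group induced on $Y$ by the setwise stabiliser of $Y$ in $G$. An embedding $(H,Y)\hookrightarrow(G,X)$ of permutation group actions is given by an injection $\Phi\colon Y\to X$ such that $h\mapsto \Phi h\Phi^{-1}$ is an isomorphism from $H$ onto $G^{\Phi(Y)}$. **Graph of group actions (gga).** A gga $\mathcal G$ consists of: a connected graph $\Delta$ (base graph); for every $v\in V\Delta$ a permutation group action $(G(v),X(v))$; for every $a\in A\Delta$ a permutation group action $(H(a),Y(a))$ with $(H(\bar a),Y(\bar a))=(H(a),Y(a))$ and an embedding $\Phi_a\colon(H(a),Y(a))\hookrightarrow(G(t(a)),X(t(a)))$;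 and for every self-reverse arc $a$ a permutation $h_a$ of $Y(a)$ with $h_aH(a)h_a^{-1}=H(a)$ and $h_a^2\in H(a)$ (inversion agent). An $a$-adhesion map is a map $g\Phi_a\colon Y(a)\to X(t(a))$ with $g\in G(t(a))$; its image is called an $a$-adhesion set. If $a$ is self-reverse, a twisted $a$-adhesion map is a map $g\Phi_ah_a$ with $g\in G(t(a))$. **Scaffolding.** A scaffolding $(\Sigma,\sim,\pi,p)$ for $\mathcal G$ is a graph $\Sigma$ with an equivalence relation $\sim$ on $V\Sigma$, extended to $A\Sigma$ by $a\sim a'$ iff $o(a)\sim o(a')$ and $t(a)\sim t(a')$ (write $[x]$ for the class of $x$ as a set, called a vertex or arc bundle, and $\llbracket x\rrbracket$ for the class as a vertex or arc of $T_\Sigma:=\Sigma/\!\sim$), such that: (i) $T_\Sigma$ is a tree; (ii) no arc of $\Sigma$ has both ends in the same vertex bundle; (iii) $\pi\colon T_\Sigma\to\Delta$ is a graph morphism; (iv) $p$ is a legal colouring, i.e. a map from $V\Sigma\cup A\Sigma$ to $\bigcup_v X(v)\cup\bigcup_a Y(a)$ such that: $p$ restricts to bijections $[v]\to X(\pi(\llbracket v\rrbracket))$ and $[a]\to Y(\pi(\llbracket a\rrbracket))$ for all vertices $v$ and arcs $a$ of $\Sigma$; $p(\bar b)=p(b)$ for every arc $b$; if $\Psi_{\llbracket a\rrbracket}\colon Y(\pi(\llbracket a\rrbracket))\to X(\pi(t(\llbracket a\rrbracket)))$ is the unique map with $\Psi_{\llbracket a\rrbracket}(p(b))=p(t(b))$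 for all $b\in[a]$, then $\Psi_{\llbracket a\rrbracket}$ is a $\pi(\llbracket a\rrbracket)$-adhesion map when $\pi(\llbracket a\rrbracket)$ is not self-reverse, while when $\pi(\llbracket a\rrbracket)$ is self-reverse one of $\Psi_{\llbracket a\rrbracket},\Psi_{\llbracket\bar a\rrbracket}$ is a $\pi(\llbracket a\rrbracket)$-adhesion map and the other is a twisted $\pi(\llbracket a\rrbracket)$-adhesion map; and for every vertex $\llbracket v\rrbracket$ of $T_\Sigma$, every $b\in A\Delta$ with $t(b)=\pi(\llbracket v\rrbracket)$ and every $b$-adhesion set $S$, there is exactly one arc $\llbracket a\rrbracket$ of $T_\Sigma$ with $t(\llbracket a\rrbracket)=\llbracket v\rrbracket$, $\pi(\llbracket a\rrbracket)=b$ and $\Psi_{\llbracket a\rrbracket}(Y(b))=S$. **Automorphisms.** $\mathrm{Aut}_{\mathrm{sc}}(\Sigma)$ (scaffolding automorphisms) is the group of graph automorphisms $g$ of $\Sigma$ with $x\sim y\iff g(x)\sim g(y)$ and $\pi(\llbracket g(x)\rrbracket)=\pi(\llbracket x\rrbracket)$ for all vertices and arcs $x,y$. For a legal colouring $p$, the local action of $g\in \mathrm{Aut}_{\mathrm{sc}}(\Sigma)$ at $\llbracket v\rrbracket\in VT_\Sigma$ with respect to $p$ is the permutation $g_{\llbracket v\rrbracket}$ of $X(\pi(\llbracket v\rrbracket))$ with $g_{\llbracket v\rrbracket}(p(x))=p(g(x))$ for all $x\in[v]$. The universal group $\mathcal U(\mathcal G)$ with respect to $\Sigma$ and $p$ consists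 of all $g\in\mathrm{Aut}_{\mathrm{sc}}(\Sigma)$ with $g_{\llbracket v\rrbracket}\in G(\pi(\llbracket v\rrbracket))$ for all $\llbracket v\rrbracket\in VT_\Sigma$. A subgroup $H\le\mathrm{Aut}_{\mathrm{sc}}(\Sigma)$ is locally-$\mathcal G$ if there is a legal colouring $p'$ of $\Sigma$ (for the same $\sim$ and $\pi$) such that for every $h\in H$ and every $\llbracket v\rrbracket\in VT_\Sigma$ the local action of $h$ at $\llbracket v\rrbracket$ with respect to $p'$ lies in $G(\pi(\llbracket v\rrbracket))$. *)

theory Defs
  imports "HOL-Algebra.Group_Action"
begin

section \<open>Graphs with arc reversal\<close>

record ('v, 'a) rgraph =
  verts :: "'v set"
  arcs :: "'a set"
  origin :: "'a \<Rightarrow> 'v"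
  terminus :: "'a \<Rightarrow> 'v"
  arev :: "'a \<Rightarrow> 'a"

definition graph :: "('v, 'a) rgraph \<Rightarrow> bool" where
  "graph G \<longleftrightarrow>
     (\<forall>a\<in>arcs G. origin G a \<in> verts G \<and> terminus G a \<in> verts G \<and> arev G a \<in> arcs G \<and>
        arev G (arev G a) = a \<and> origin G a = terminus G (arev G a))"

definition connected_graph :: "('v, 'a) rgraph \<Rightarrow> bool" where
  "connected_graph G \<longleftrightarrow>
     (\<forall>u\<in>verts G. \<forall>v\<in>verts G. (u, v) \<in> {(origin G a, terminus G a) | a. a \<in> arcs G}\<^sup>*)"

definition simple_cycle :: "('v, 'a) rgraph \<Rightarrow> 'a list \<Rightarrow> bool" where
  "simple_cycle G as \<longleftrightarrow>
     as \<noteq> [] \<and> set as \<subseteq> arcs G \<and>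
     (\<forall>i<length as. terminus G (as ! i) = origin G (as ! (Suc i mod length as))) \<and>
     distinct (map (origin G) as)"

definition tree :: "('v, 'a) rgraph \<Rightarrow> bool" where
  "tree G \<longleftrightarrow>
     graph G \<and> connected_graph G \<and>
     (\<forall>a\<in>arcs G. origin G a \<noteq> terminus G a) \<and>
     (\<forall>a\<in>arcs G. \<forall>b\<in>arcs G. origin G a = origin G b \<longrightarrow> terminus G a = terminus G b \<longrightarrow> a = b) \<and>
     (\<nexists>as. simple_cycle G as \<and> length as \<ge> 3)"

text \<open>Maps defined on the vertices and on the arcs of a graph (morphisms, colourings) are pairs.\<close>

abbreviation vmap :: "('v \<Rightarrow> 'w) \<times> ('a \<Rightarrow> 'b) \<Rightarrow> 'v \<Rightarrow> 'w" where "vmap \<equiv> fst"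
abbreviation amap :: "('v \<Rightarrow> 'w) \<times> ('a \<Rightarrow> 'b) \<Rightarrow> 'a \<Rightarrow> 'b" where "amap \<equiv> snd"

definition graph_morphism ::
  "('v, 'a) rgraph \<Rightarrow> ('w, 'b) rgraph \<Rightarrow> ('v \<Rightarrow> 'w) \<times> ('a \<Rightarrow> 'b) \<Rightarrow> bool" where
  "graph_morphism G K f \<longleftrightarrow>
     vmap f \<in> verts G \<rightarrow> verts K \<and> amap f \<in> arcs G \<rightarrow> arcs K \<and>
     (\<forall>a\<in>arcs G. origin K (amap f a) = vmap f (origin G a) \<and>
                 terminus K (amap f a) = vmap f (terminus G a) \<and>
                 arev K (amap f a) = amap f (arev G a))"


section \<open>Permutation group actions\<close>

record ('g, 'x) gaction =
  grp :: "'g monoid"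
  pts :: "'x set"
  act :: "'g \<Rightarrow> 'x \<Rightarrow> 'x"

definition perm_group_action :: "('g, 'x) gaction \<Rightarrow> bool" where
  "perm_group_action A \<longleftrightarrow> faithful_action (grp A) (pts A) (act A) \<and> pts A \<noteq> {}"

text \<open>The acting group, viewed as a set of permutations of the (non-empty) set acted upon.\<close>

definition perms :: "('g, 'x) gaction \<Rightarrow> ('x \<Rightarrow> 'x) set" where
  "perms A = act A ` carrier (grp A)"

definition induced_group :: "('g, 'x) gaction \<Rightarrow> 'x set \<Rightarrow> ('x \<Rightarrow> 'x) monoid" where
  "induced_group A Y = (BijGroup Y)\<lparr>carrier := {restrict g Y | g. g \<in> perms A \<and> g ` Y = Y}\<rparr>"

definition embedding :: "('y \<Rightarrow> 'x) \<Rightarrow> ('h, 'y) gaction \<Rightarrow> ('g, 'x) gaction \<Rightarrow> bool" where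
  "embedding \<Phi> B A \<longleftrightarrow>
     \<Phi> \<in> pts B \<rightarrow> pts A \<and> inj_on \<Phi> (pts B) \<and>
     (\<lambda>h. \<lambda>x\<in>\<Phi> ` pts B. \<Phi> (act B h (inv_into (pts B) \<Phi> x)))
       \<in> iso (grp B) (induced_group A (\<Phi> ` pts B))"


section \<open>Graphs of group actions\<close>

record ('v, 'a, 'g, 'x, 'h, 'y) gga =
  base :: "('v, 'a) rgraph"
  vact :: "'v \<Rightarrow> ('g, 'x) gaction"
  aact :: "'a \<Rightarrow> ('h, 'y) gaction"
  emb :: "'a \<Rightarrow> 'y \<Rightarrow> 'x"
  agent :: "'a \<Rightarrow> 'y \<Rightarrow> 'y"  \<comment> \<open>inversion agents; meaningful on self-reverse arcs only\<close>

abbreviation self_reverse :: "('v, 'a, 'g, 'x, 'h, 'y) gga \<Rightarrow> 'a \<Rightarrow> bool" where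
  "self_reverse \<G> a \<equiv> arev (base \<G>) a = a"

definition inversion_agent :: "('h, 'y) gaction \<Rightarrow> ('y \<Rightarrow> 'y) \<Rightarrow> bool" where
  "inversion_agent B h \<longleftrightarrow>
     (let P = BijGroup (pts B) in
        h \<in> carrier P \<and> h <#\<^bsub>P\<^esub> perms B #>\<^bsub>P\<^esub> inv\<^bsub>P\<^esub> h = perms B \<and> h \<otimes>\<^bsub>P\<^esub> h \<in> perms B)"

definition graph_of_group_actions :: "('v, 'a, 'g, 'x, 'h, 'y) gga \<Rightarrow> bool" where
  "graph_of_group_actions \<G> \<longleftrightarrow>
     graph (base \<G>) \<and> connected_graph (base \<G>) \<and>
     (\<forall>v\<in>verts (base \<G>). perm_group_action (vact \<G> v)) \<and>
     (\<forall>a\<in>arcs (base \<G>).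
        perm_group_action (aact \<G> a) \<and>
        aact \<G> (arev (base \<G>) a) = aact \<G> a \<and>
        embedding (emb \<G> a) (aact \<G> a) (vact \<G> (terminus (base \<G>) a)) \<and>
        (self_reverse \<G> a \<longrightarrow> inversion_agent (aact \<G> a) (agent \<G> a)))"

definition adhesion_maps :: "('v, 'a, 'g, 'x, 'h, 'y) gga \<Rightarrow> 'a \<Rightarrow> ('y \<Rightarrow> 'x) set" where
  "adhesion_maps \<G> a =
     {compose (pts (aact \<G> a)) g (emb \<G> a) | g. g \<in> perms (vact \<G> (terminus (base \<G>) a))}"

definition twisted_adhesion_maps :: "('v, 'a, 'g, 'x, 'h, 'y) gga \<Rightarrow> 'a \<Rightarrow> ('y \<Rightarrow> 'x) set" where
  "twisted_adhesion_maps \<G> a =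
     {compose (pts (aact \<G> a)) g (compose (pts (aact \<G> a)) (emb \<G> a) (agent \<G> a)) | g.
        g \<in> perms (vact \<G> (terminus (base \<G>) a))}"

definition adhesion_sets :: "('v, 'a, 'g, 'x, 'h, 'y) gga \<Rightarrow> 'a \<Rightarrow> 'x set set" where
  "adhesion_sets \<G> a = {\<psi> ` pts (aact \<G> a) | \<psi>. \<psi> \<in> adhesion_maps \<G> a}"


section \<open>Scaffoldings\<close>

text \<open>
  The equivalence relation on vertices is a set \<open>r\<close> of pairs, and bundles are its classes.
  The vertices and arcs of the quotient graph are the vertex and arc bundles themselves.
\<close>

definition arc_rel :: "('v, 'a) rgraph \<Rightarrow> ('v \<times> 'v) set \<Rightarrow> ('a \<times> 'a) set" where
  "arc_rel S r = {(a, b). a \<in> arcs S \<and> b \<in> arcs S \<and>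
     (origin S a, origin S b) \<in> r \<and> (terminus S a, terminus S b) \<in> r}"

definition quotient_graph :: "('v, 'a) rgraph \<Rightarrow> ('v \<times> 'v) set \<Rightarrow> ('v set, 'a set) rgraph" where
  "quotient_graph S r =
     \<lparr>verts = verts S // r,
      arcs = arcs S // arc_rel S r,
      origin = (\<lambda>A. r `` (origin S ` A)),
      terminus = (\<lambda>A. r `` (terminus S ` A)),
      arev = (\<lambda>A. arev S ` A)\<rparr>"

text \<open>
  For a colouring \<open>p\<close> and an arc \<open>A\<close> of the quotient graph this is the map \<open>\<Psi>\<close>
  sending the colour of each arc in \<open>A\<close> to the colour of its terminus.
\<close>

definition bundle_map ::
  "('v, 'a, 'g, 'x, 'h, 'y) gga \<Rightarrow> ('sv, 'sa) rgraph \<Rightarrow> ('sv \<times> 'sv) set \<Rightarrow>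
   ('sv set \<Rightarrow> 'v) \<times> ('sa set \<Rightarrow> 'a) \<Rightarrow> ('sv \<Rightarrow> 'x) \<times> ('sa \<Rightarrow> 'y) \<Rightarrow> 'sa set \<Rightarrow> 'y \<Rightarrow> 'x" where
  "bundle_map \<G> S r \<pi> p A =
     (THE \<psi>. \<psi> \<in> pts (aact \<G> (amap \<pi> A)) \<rightarrow>\<^sub>E
                  pts (vact \<G> (vmap \<pi> (terminus (quotient_graph S r) A))) \<and>
             (\<forall>b\<in>A. \<psi> (amap p b) = vmap p (terminus S b)))"

definition legal_colouring ::
  "('v, 'a, 'g, 'x, 'h, 'y) gga \<Rightarrow> ('sv, 'sa) rgraph \<Rightarrow> ('sv \<times> 'sv) set \<Rightarrow>
   ('sv set \<Rightarrow> 'v) \<times> ('sa set \<Rightarrow> 'a) \<Rightarrow> ('sv \<Rightarrow> 'x) \<times> ('sa \<Rightarrow> 'y) \<Rightarrow> bool" where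
  "legal_colouring \<G> S r \<pi> p \<longleftrightarrow>
     (let T = quotient_graph S r; \<Psi> = bundle_map \<G> S r \<pi> p in
        (\<forall>V\<in>verts T. bij_betw (vmap p) V (pts (vact \<G> (vmap \<pi> V)))) \<and>
        (\<forall>A\<in>arcs T. bij_betw (amap p) A (pts (aact \<G> (amap \<pi> A)))) \<and>
        (\<forall>b\<in>arcs S. amap p (arev S b) = amap p b) \<and>
        (\<forall>A\<in>arcs T. let a = amap \<pi> A in
           if self_reverse \<G> a
           then (\<Psi> A \<in> adhesion_maps \<G> a \<and> \<Psi> (arev T A) \<in> twisted_adhesion_maps \<G> a) \<or>
                (\<Psi> A \<in> twisted_adhesion_maps \<G> a \<and> \<Psi> (arev T A) \<in> adhesion_maps \<G> a)
           else \<Psi> A \<in> adhesion_maps \<G> a) \<and>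
        (\<forall>V\<in>verts T. \<forall>b\<in>arcs (base \<G>). terminus (base \<G>) b = vmap \<pi> V \<longrightarrow>
           (\<forall>Z\<in>adhesion_sets \<G> b.
              \<exists>!A. A \<in> arcs T \<and> terminus T A = V \<and> amap \<pi> A = b \<and> \<Psi> A ` pts (aact \<G> b) = Z)))"

definition scaffolding ::
  "('v, 'a, 'g, 'x, 'h, 'y) gga \<Rightarrow> ('sv, 'sa) rgraph \<Rightarrow> ('sv \<times> 'sv) set \<Rightarrow>
   ('sv set \<Rightarrow> 'v) \<times> ('sa set \<Rightarrow> 'a) \<Rightarrow> ('sv \<Rightarrow> 'x) \<times> ('sa \<Rightarrow> 'y) \<Rightarrow> bool" where
  "scaffolding \<G> S r \<pi> p \<longleftrightarrow>
     graph S \<and> equiv (verts S) r \<and>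
     tree (quotient_graph S r) \<and>
     (\<forall>a\<in>arcs S. (origin S a, terminus S a) \<notin> r) \<and>
     graph_morphism (quotient_graph S r) (base \<G>) \<pi> \<and>
     legal_colouring \<G> S r \<pi> p"


section \<open>Scaffolding automorphisms and universal groups\<close>

text \<open>
  An automorphism is a pair of permutations, one of the vertices and one of the arcs,
  so the group structure is inherited from the direct product of the two symmetric groups.
\<close>

definition aut_sc ::
  "('sv, 'sa) rgraph \<Rightarrow> ('sv \<times> 'sv) set \<Rightarrow> ('sv set \<Rightarrow> 'v) \<times> ('sa set \<Rightarrow> 'a) \<Rightarrow>
   (('sv \<Rightarrow> 'sv) \<times> ('sa \<Rightarrow> 'sa)) monoid" where
  "aut_sc S r \<pi> = (BijGroup (verts S) \<times>\<times> BijGroup (arcs S))\<lparr>carrier :=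
     {g \<in> carrier (BijGroup (verts S) \<times>\<times> BijGroup (arcs S)).
        graph_morphism S S g \<and>
        (\<forall>x\<in>verts S. \<forall>y\<in>verts S. (x, y) \<in> r \<longleftrightarrow> (vmap g x, vmap g y) \<in> r) \<and>
        (\<forall>x\<in>arcs S. \<forall>y\<in>arcs S. (x, y) \<in> arc_rel S r \<longleftrightarrow> (amap g x, amap g y) \<in> arc_rel S r) \<and>
        (\<forall>x\<in>verts S. vmap \<pi> (r `` {vmap g x}) = vmap \<pi> (r `` {x})) \<and>
        (\<forall>x\<in>arcs S. amap \<pi> (arc_rel S r `` {amap g x}) = amap \<pi> (arc_rel S r `` {x}))}\<rparr>"

definition local_action ::
  "('v, 'a, 'g, 'x, 'h, 'y) gga \<Rightarrow> ('sv set \<Rightarrow> 'v) \<times> ('sa set \<Rightarrow> 'a) \<Rightarrow>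
   ('sv \<Rightarrow> 'x) \<times> ('sa \<Rightarrow> 'y) \<Rightarrow> ('sv \<Rightarrow> 'sv) \<times> ('sa \<Rightarrow> 'sa) \<Rightarrow> 'sv set \<Rightarrow> 'x \<Rightarrow> 'x" where
  "local_action \<G> \<pi> p g V =
     (THE \<sigma>. \<sigma> \<in> carrier (BijGroup (pts (vact \<G> (vmap \<pi> V)))) \<and>
             (\<forall>x\<in>V. \<sigma> (vmap p x) = vmap p (vmap g x)))"

definition universal_group ::
  "('v, 'a, 'g, 'x, 'h, 'y) gga \<Rightarrow> ('sv, 'sa) rgraph \<Rightarrow> ('sv \<times> 'sv) set \<Rightarrow>
   ('sv set \<Rightarrow> 'v) \<times> ('sa set \<Rightarrow> 'a) \<Rightarrow> ('sv \<Rightarrow> 'x) \<times> ('sa \<Rightarrow> 'y) \<Rightarrow>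
   (('sv \<Rightarrow> 'sv) \<times> ('sa \<Rightarrow> 'sa)) monoid" where
  "universal_group \<G> S r \<pi> p = (aut_sc S r \<pi>)\<lparr>carrier :=
     {g \<in> carrier (aut_sc S r \<pi>). \<forall>V\<in>verts (quotient_graph S r).
        local_action \<G> \<pi> p g V \<in> perms (vact \<G> (vmap \<pi> V))}\<rparr>"

definition locally_gga ::
  "('v, 'a, 'g, 'x, 'h, 'y) gga \<Rightarrow> ('sv, 'sa) rgraph \<Rightarrow> ('sv \<times> 'sv) set \<Rightarrow>
   ('sv set \<Rightarrow> 'v) \<times> ('sa set \<Rightarrow> 'a) \<Rightarrow> (('sv \<Rightarrow> 'sv) \<times> ('sa \<Rightarrow> 'sa)) set \<Rightarrow> bool" where
  "locally_gga \<G> S r \<pi> H \<longleftrightarrow>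
     (\<exists>p'. legal_colouring \<G> S r \<pi> p' \<and>
        (\<forall>h\<in>H. \<forall>V\<in>verts (quotient_graph S r).
           local_action \<G> \<pi> p' h V \<in> perms (vact \<G> (vmap \<pi> V))))"

end

theory Submission
  imports Defs
begin

text \<open>
  Let \<open>p'\<close> be a legal colouring with respect to which the local actions of \<open>H\<close> lie in the vertex groups.
  The point is to find a scaffolding automorphism \<open>g\<close> such that on every vertex bundle \<open>p \<circ> g\<close> and \<open>p'\<close>
  differ by an element of the vertex group; the local actions of \<open>g H g\<inverse>\<close> with respect to \<open>p\<close> are then
  products of elements of vertex groups. Given \<open>g\<close> on one bundle, the adhesion set of an arc bundle ending
  there is moved to an adhesion set, which determines the image of the arc bundle. The induced
  permutation of the arc colours lies in the arc group up to inversion agents, so it extends to an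
  element of the vertex group at the other end. As the quotient is a tree, these choices fit together; the
  resulting map of the tree is locally bijective and hence an automorphism.
\<close>

section \<open>Trees\<close>

text \<open>The delicate arcs are the self-reverse ones. There legality says that one of the two
  bundle maps of a bundle and its reverse is twisted, but not which one, so two legal colourings may
  twist opposite sides. Comparing them can lead out of the arc group by an inversion agent
  \<open>h\<close>. As \<open>h\<close> normalises the arc group and has its square in it, the
  permutation of arc colours still amounts to an element of the arc group at either end, once the
  twists there are removed. The other obstacle is that crossing an arc is not canonical: the element
  of the vertex group at the far end is prescribed on an adhesion set only. So choices are made, and
  nothing ensures in advance that the resulting map of the tree is invertible. For this reason
  compatibility is an equivalence on arcs, and the uniqueness of the arc with a given adhesion set
  serves twice: for \<open>p\<close> to lift neighbours, for \<open>p'\<close> to separate them. The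
  map is built on vertices alone, since an arc of the scaffolding is determined by its ends.\<close>

definition adj :: "('v, 'a) rgraph \<Rightarrow> ('v \<times> 'v) set" where
  "adj G = {(origin G a, terminus G a) | a. a \<in> arcs G}"

lemma graph_adj:
  assumes "graph G" "(u, v) \<in> adj G"
  shows "(v, u) \<in> adj G" "u \<in> verts G" "v \<in> verts G"
proof -
  obtain a where a: "a \<in> arcs G" "u = origin G a" "v = terminus G a"
    using assms(2) by (auto simp: adj_def)
  have *: "arev G a \<in> arcs G" "arev G (arev G a) = a" "origin G a = terminus G (arev G a)"
    "origin G (arev G a) = terminus G (arev G (arev G a))"
    using assms(1) a(1) unfolding graph_def by blast+
  then show "(v, u) \<in> adj G"
    unfolding adj_def a by (smt (verit) mem_Collect_eq)
  show "u \<in> verts G" "v \<in> verts G"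
    using assms(1) a unfolding graph_def by blast+
qed

text \<open>Cycles in \<open>tree\<close> are lists of arcs. Choosing one arc for each consecutive
  pair gives such a list, and its origins are the given distinct vertices.\<close>

lemma tree_no_cyclic_path:
  assumes "tree G" "distinct vs" "length vs \<ge> 3"
    and E: "\<And>i. i < length vs \<Longrightarrow> (vs ! i, vs ! (Suc i mod length vs)) \<in> adj G"
  shows False
proof -
  have "\<forall>i. \<exists>a. i < length vs \<longrightarrow>
      a \<in> arcs G \<and> origin G a = vs ! i \<and> terminus G a = vs ! (Suc i mod length vs)"
    using E unfolding adj_def by fastforce
  then obtain f where f: "\<And>i. i < length vs \<Longrightarrow>
      f i \<in> arcs G \<and> origin G (f i) = vs ! i \<and> terminus G (f i) = vs ! (Suc i mod length vs)"
    by metis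
  let ?as = "map f [0..<length vs]"
  have m: "map (origin G) ?as = vs"
    using f by (intro nth_equalityI) auto
  have pos: "length vs > 0"
    using assms(3) by linarith
  then have "?as \<noteq> []"
    by auto
  moreover have "Suc i mod length vs < length vs" for i
    using pos by (simp only: mod_less_divisor)
  moreover have "set ?as \<subseteq> arcs G"
    using f by auto
  ultimately have "simple_cycle G ?as"
    unfolding simple_cycle_def using f m assms(2) by simp
  then show False
    using assms(1,3) unfolding tree_def by (metis length_map length_upt minus_nat.diff_0)
qed

text \<open>A walk that returns to a vertex already visited is cut back to that visit. The clause on
  \<open>Range E\<close> serves restricted relations: it shows that the path stays inside the region
  to which \<open>E\<close> is restricted.\<close>

lemma rtrancl_distinct_path:
  assumes "(x, y) \<in> E\<^sup>*"
  shows "\<exists>xs. xs \<noteq> [] \<and> distinct xs \<and> hd xs = x \<and> last xs = y \<and>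
    successively (\<lambda>u v. (u, v) \<in> E) xs \<and> set xs \<subseteq> insert x (Range E)"
  using assms
proof (induction rule: rtrancl_induct)
  case base
  show ?case by (rule exI[of _ "[x]"]) auto
next
  case (step y z)
  then obtain xs where xs: "xs \<noteq> []" "distinct xs" "hd xs = x" "last xs = y"
    "successively (\<lambda>u v. (u, v) \<in> E) xs" "set xs \<subseteq> insert x (Range E)" by blast
  show ?case
  proof (cases "z \<in> set xs")
    case True
    then obtain as bs where "xs = as @ z # bs"
      by (meson split_list)
    with xs show ?thesis
      by (intro exI[of _ "as @ [z]"]) (auto simp: successively_append_iff hd_append split: if_splits)
  next
    case False
    with xs step.hyps show ?thesis
      by (intro exI[of _ "xs @ [z]"]) (auto simp: successively_append_iff)
  qed
qed

text \<open>If \<open>u\<close> and \<open>v\<close> were different, a path between them inside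
  \<open>D\<close> would close up through \<open>w\<close>, which lies outside, to a cycle of length
  at least 3.\<close>

lemma tree_unique_neighbour:
  assumes "tree G" "w \<notin> D" "u \<in> D" "(w, u) \<in> adj G" "(v, w) \<in> adj G"
    and "(u, v) \<in> (adj G \<inter> D \<times> D)\<^sup>*"
  shows "u = v"
proof (rule ccontr)
  assume "u \<noteq> v"
  obtain xs where xs: "xs \<noteq> []" "distinct xs" "hd xs = u" "last xs = v"
    "successively (\<lambda>u v. (u, v) \<in> adj G \<inter> D \<times> D) xs" "set xs \<subseteq> insert u (Range (adj G \<inter> D \<times> D))"
    using rtrancl_distinct_path[OF assms(6)] by blast
  have "length xs \<noteq> 1"
    using xs \<open>u \<noteq> v\<close> by (metis One_nat_def cancel_comm_monoid_add_class.diff_cancel hd_conv_nth last_conv_nth)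
  then have "length xs \<ge> 2"
    using xs(1) by (cases xs; cases "tl xs") auto
  moreover have "w \<notin> set xs"
    using xs(6) assms(2,3) by auto
  moreover have "((w # xs) ! i, (w # xs) ! (Suc i mod length (w # xs))) \<in> adj G"
    if "i < length (w # xs)" for i
  proof -
    \<comment> \<open>Position 0 is the edge leaving \<open>w\<close>, position
      \<open>length xs\<close> wraps around to \<open>w\<close>, and the others lie on the path,
      shifted by one.\<close>
    have "i = 0 \<or> i = length xs \<and> i \<noteq> 0 \<or> (\<exists>j. i = Suc j \<and> Suc j < length xs)"
      using that by (cases i) auto
    then consider "i = 0" | "i = length xs" "i \<noteq> 0" | j where "i = Suc j" "Suc j < length xs"
      by blast
    then show ?thesis
    proof cases
      case 1
      then show ?thesis using xs assms(4) by (simp add: hd_conv_nth)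
    next
      case 2
      then show ?thesis using xs assms(5) by (simp add: last_conv_nth nth_Cons')
    next
      case 3
      then show ?thesis using successively_nth[OF xs(5)] by auto
    qed
  qed
  ultimately show False
    using tree_no_cyclic_path[OF assms(1), of "w # xs"] xs(2) by simp
qed

text \<open>Compatible data are chosen along the tree by recursion on the distance from the root: a vertex
  has only one neighbour that is not farther from the root, so no other constraint arises.\<close>

lemma tree_section:
  assumes tree: "tree G" and v0: "v0 \<in> verts G" "P v0 t0"
    and step: "\<And>v w t. (v, w) \<in> adj G \<Longrightarrow> P v t \<Longrightarrow> \<exists>u. P w u \<and> Q v w t u"
    and sym: "\<And>v w t u. (v, w) \<in> adj G \<Longrightarrow> Q v w t u \<Longrightarrow> Q w v u t"
  shows "\<exists>s. s v0 = t0 \<and> (\<forall>v\<in>verts G. P v (s v)) \<and> (\<forall>(v, w)\<in>adj G. Q v w (s v) (s w))"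
proof -
  have G: "graph G" and conn: "connected_graph G" and loop: "(v, v) \<notin> adj G" for v
    using tree unfolding tree_def adj_def by auto
  note adj = graph_adj[OF G]
  define d where "d v = (LEAST n. (v0, v) \<in> adj G ^^ n)" for v
  have reach: "\<exists>n. (v0, v) \<in> adj G ^^ n" if "v \<in> verts G" for v
    using conn v0(1) that unfolding connected_graph_def adj_def by (simp add: rtrancl_power)
  have d: "(v0, v) \<in> adj G ^^ d v" if "v \<in> verts G" for v
    unfolding d_def using LeastI_ex[OF reach[OF that]] .
  have d_le: "d v \<le> n" if "(v0, v) \<in> adj G ^^ n" for v n
    unfolding d_def using that by (rule Least_le)
  have d_adj: "d w \<le> Suc (d v)" if "(v, w) \<in> adj G" for v w
    using d_le[of w "Suc (d v)"] d[OF adj(2)[OF that]] that by (auto intro: relcompI)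
  have d_eq0: "v = v0" if "v \<in> verts G" "d v = 0" for v
    using d[OF that(1)] that(2) by simp
  have d0: "d v0 = 0"
    using d_le[of v0 0] by simp
  have parent: "\<exists>u. (u, v) \<in> adj G \<and> d v = Suc (d u)" if "v \<in> verts G" "v \<noteq> v0" for v
  proof -
    have "d v \<noteq> 0"
      using d_eq0 that by blast
    then obtain n where n: "d v = Suc n"
      using not0_implies_Suc by blast
    then obtain u where u: "(v0, u) \<in> adj G ^^ n" "(u, v) \<in> adj G"
      using d[OF \<open>v \<in> verts G\<close>] by auto
    then show ?thesis
      using d_le[OF u(1)] d_adj[OF u(2)] n by auto
  qed
  \<comment> \<open>\<open>D\<close> is only required to contain the ball, because the fact is
    applied to a ball enlarged by one vertex.\<close>
  have ball: "(v0, v) \<in> (adj G \<inter> D \<times> D)\<^sup>*"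
    if "\<And>u. u \<in> verts G \<Longrightarrow> d u \<le> n \<Longrightarrow> u \<in> D" "v \<in> verts G" "d v \<le> n" for n v D
    using that(2,3)
  proof (induction "d v" arbitrary: v)
    case 0
    then show ?case using d_eq0 by auto
  next
    case (Suc k)
    then have "v \<noteq> v0" using d0 by auto
    then obtain u where u: "(u, v) \<in> adj G" "d v = Suc (d u)"
      using parent[OF Suc.prems(1)] by blast
    then have "(v0, u) \<in> (adj G \<inter> D \<times> D)\<^sup>*" "(u, v) \<in> adj G \<inter> D \<times> D"
      using Suc adj[OF u(1)] that(1) by auto
    then show ?case by (rule rtrancl_into_rtrancl)
  qed
  have symD: "sym ((adj G \<inter> D \<times> D)\<^sup>*)" for D
    by (rule sym_rtrancl) (auto simp: sym_def adj)
  have lower_unique: "u = v"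
    if "(u, w) \<in> adj G" "(v, w) \<in> adj G" "d w = Suc (d u)" "d v \<le> d w" for u v w
  proof -
    \<comment> \<open>This region avoids \<open>w\<close> and is connected: \<open>v\<close> may be
      as far from the root as \<open>w\<close>, but then it hangs on the ball through a parent of
      its own. The conclusion \<open>u = v\<close> thereby also excludes edges between equidistant
      vertices.\<close>
    let ?D = "insert v {x \<in> verts G. d x \<le> d u}"
    have u0: "(v0, u) \<in> (adj G \<inter> ?D \<times> ?D)\<^sup>*"
      using ball[of "d u" ?D u] adj[OF that(1)] by auto
    have vv: "v \<in> verts G" "w \<in> verts G"
      using adj[OF that(2)] by auto
    have "(v0, v) \<in> (adj G \<inter> ?D \<times> ?D)\<^sup>*"
    proof (cases "d v \<le> d u")
      case True
      then show ?thesis using ball[of "d u" ?D v] vv by auto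
    next
      case False
      then have dv: "d v = Suc (d u)" using that by auto
      then have "v \<noteq> v0" using d0 by auto
      then obtain z where z: "(z, v) \<in> adj G" "d v = Suc (d z)"
        using parent vv by blast
      then have "(v0, z) \<in> (adj G \<inter> ?D \<times> ?D)\<^sup>*" "(z, v) \<in> adj G \<inter> ?D \<times> ?D"
        using ball[of "d u" ?D z] adj[OF z(1)] dv by auto
      then show ?thesis by (rule rtrancl_into_rtrancl)
    qed
    then have "(u, v) \<in> (adj G \<inter> ?D \<times> ?D)\<^sup>*"
      using u0 symD[of ?D] by (blast intro: rtrancl_trans dest: Relation.symD)
    moreover have "w \<notin> ?D"
      using that loop by auto
    ultimately show ?thesis
      using tree_unique_neighbour[OF tree, of w ?D u v] that adj by auto
  qed
  define par where "par v = (SOME u. (u, v) \<in> adj G \<and> d v = Suc (d u))" for v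
  have par: "(par v, v) \<in> adj G" "d v = Suc (d (par v))" if "v \<in> verts G" "v \<noteq> v0" for v
    using someI_ex[OF parent[OF that]] unfolding par_def by auto
  \<comment> \<open>The choice at \<open>v\<close> refers to earlier values only through
    \<open>par v\<close>, so the parent relation itself is the well-founded relation. Outside the
    tree the value is arbitrary.\<close>
  let ?R = "\<lambda>f v t. (v = v0 \<longrightarrow> t = t0) \<and>
    (v \<in> verts G \<longrightarrow> P v t \<and> (v \<noteq> v0 \<longrightarrow> Q (par v) v (f (par v)) t))"
  have "\<exists>s. \<forall>v. ?R s v (s v)"
  proof (rule dependent_wf_choice)
    show "wf {(par v, v) | v. v \<in> verts G \<and> v \<noteq> v0}"
      by (rule wf_subset[OF wf_measure[of d]]) (auto dest: par)
    show "?R f v t = ?R g v t" if "\<And>z. (z, v) \<in> {(par v, v) | v. v \<in> verts G \<and> v \<noteq> v0} \<Longrightarrow> f z = g z"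
      for f g v t
    proof -
      have "f (par v) = g (par v)" if "v \<in> verts G" "v \<noteq> v0"
        using \<open>\<And>z. (z, v) \<in> _ \<Longrightarrow> f z = g z\<close> that by blast
      then show ?thesis by auto
    qed
    show "\<exists>t. ?R f v t" if IH: "\<And>z. (z, v) \<in> {(par v, v) | v. v \<in> verts G \<and> v \<noteq> v0} \<Longrightarrow> ?R f z (f z)"
      for v f
    proof (cases "v \<in> verts G \<and> v \<noteq> v0")
      case True
      then have "P (par v) (f (par v))"
        using IH[of "par v"] adj[OF par(1)] by auto
      then show ?thesis
        using step[OF par(1)] True by blast
    next
      case False
      then show ?thesis using v0 by auto
    qed
  qed
  then obtain s where s: "\<And>v. ?R s v (s v)" by blast
  have "Q v w (s v) (s w)" if vw: "(v, w) \<in> adj G" for v w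
  proof -
    \<comment> \<open>Every edge is the parent edge of its farther end, so \<open>Q\<close> was
      secured for it by construction, up to orientation.\<close>
    have lower: "par x = y \<and> x \<noteq> v0" if "(y, x) \<in> adj G" "d y \<le> d x" for x y
    proof -
      have "x \<noteq> v0"
        using that d_eq0[of y] adj[OF that(1)] d0 loop by auto
      then show ?thesis
        using lower_unique[of "par x" x y] par[of x] that adj[OF that(1)] by auto
    qed
    show ?thesis
    proof (cases "d v \<le> d w")
      case True
      then show ?thesis using lower[OF vw] s[of w] adj[OF vw] by auto
    next
      case False
      then have "par v = w" "v \<noteq> v0" using lower[of w v] adj[OF vw] by auto
      then have "Q w v (s w) (s v)" using s[of v] adj[OF vw] by auto
      then show ?thesis using sym adj(1)[OF vw] by blast
    qed
  qed
  then show ?thesis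
    using s by (intro exI[of _ s]) auto
qed

text \<open>A section of the covering that is itself locally surjective provides the inverse.\<close>

lemma tree_covering_bij:
  assumes tree: "tree G" and F: "f \<in> verts G \<rightarrow> verts G"
    and surj: "\<And>v w'. v \<in> verts G \<Longrightarrow> (f v, w') \<in> adj G \<Longrightarrow> \<exists>w. (v, w) \<in> adj G \<and> f w = w'"
    and hom: "\<And>v w. (v, w) \<in> adj G \<Longrightarrow> (f v, f w) \<in> adj G"
    and inj: "\<And>v w w'. (v, w) \<in> adj G \<Longrightarrow> (v, w') \<in> adj G \<Longrightarrow> f w = f w' \<Longrightarrow> w = w'"
  shows "bij_betw f (verts G) (verts G)"
proof (cases "verts G = {}")
  case False
  then obtain v0 where v0: "v0 \<in> verts G" by blast
  have G: "graph G" and conn: "connected_graph G"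
    using tree unfolding tree_def by auto
  note adj = graph_adj[OF G]
  \<comment> \<open>The datum chosen at a vertex is a preimage of it, and edges are lifted by local
    surjectivity. Rooting the recursion at \<open>f v0\<close> puts \<open>v0\<close> into the image
    of \<open>s\<close>.\<close>
  obtain s where s: "s (f v0) = v0" "\<And>v. v \<in> verts G \<Longrightarrow> s v \<in> verts G \<and> f (s v) = v"
    "\<And>v w. (v, w) \<in> adj G \<Longrightarrow> (s v, s w) \<in> adj G"
  proof -
    have "\<exists>s. s (f v0) = v0 \<and> (\<forall>v\<in>verts G. s v \<in> verts G \<and> f (s v) = v) \<and>
        (\<forall>(v, w)\<in>adj G. (s v, s w) \<in> adj G)"
    proof (rule tree_section[where P = "\<lambda>v t. t \<in> verts G \<and> f t = v" and
          Q = "\<lambda>v w t u. (t, u) \<in> adj G", OF tree])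
      show "f v0 \<in> verts G" using F v0 by blast
      show "v0 \<in> verts G \<and> f v0 = f v0" using v0 by simp
      show "\<exists>u. (u \<in> verts G \<and> f u = w) \<and> (t, u) \<in> adj G"
        if "(v, w) \<in> adj G" "t \<in> verts G \<and> f t = v" for v w t
        using surj[of t w] that adj by blast
      show "(u, t) \<in> adj G" if "(t, u) \<in> adj G" for t u
        using adj(1)[OF that] .
    qed
    then show thesis using that by blast
  qed
  \<comment> \<open>The image of \<open>s\<close> is closed under neighbours: if \<open>w\<close> is
    adjacent to a vertex in it, then \<open>w\<close> and \<open>s (f w)\<close> are neighbours of
    that vertex with the same image under \<open>f\<close>, so local injectivity identifies them.
    Connectedness does the rest.\<close>
  have "v \<in> s ` verts G" if "v \<in> verts G" for v
  proof -
    have "(v0, v) \<in> (adj G)\<^sup>*"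
      using conn that v0 unfolding connected_graph_def adj_def by blast
    then show ?thesis
    proof (induction rule: rtrancl_induct)
      case base
      then show ?case using s(1) F v0 by force
    next
      case (step v w)
      then obtain v' where v': "v' \<in> verts G" "v = s v'" by blast
      have "f v = v'" using v' s(2) by blast
      then have "(v', f w) \<in> adj G" using hom[OF step(2)] by simp
      then have "(v, s (f w)) \<in> adj G" "f (s (f w)) = f w" "f w \<in> verts G"
        using s(2,3) v' adj by blast+
      then have "s (f w) = w" using inj[of v "s (f w)" w] step(2) by blast
      then show ?case using \<open>f w \<in> verts G\<close> by force
    qed
  qed
  then have "verts G = s ` verts G"
    using s(2) by blast
  then have "s (f v) = v" if "v \<in> verts G" for v
    using s(2) that by (metis imageE)
  moreover have "s ` verts G \<subseteq> verts G"
    using s(2) by blast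
  ultimately show ?thesis
    using s(2) F by (intro bij_betw_byWitness[where f' = s]) auto
qed (simp add: bij_betw_def)

section \<open>Permutation groups\<close>

lemma BijGroup_simps:
  "carrier (BijGroup X) = Bij X" "\<one>\<^bsub>BijGroup X\<^esub> = (\<lambda>x\<in>X. x)"
  "f \<in> Bij X \<Longrightarrow> g \<in> Bij X \<Longrightarrow> f \<otimes>\<^bsub>BijGroup X\<^esub> g = compose X f g"
  by (simp_all add: BijGroup_def)

lemma Bij_bij_betw: "f \<in> Bij X \<Longrightarrow> bij_betw f X X"
  by (simp add: Bij_def)

lemma subgroup_perms:
  assumes "perm_group_action A"
  shows "subgroup (perms A) (BijGroup (pts A))"
proof -
  have "group_hom (grp A) (BijGroup (pts A)) (act A)"
    using assms unfolding perm_group_action_def faithful_action_def group_action_def by blast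
  then show ?thesis
    unfolding perms_def by (rule group_hom.img_is_subgroup)
qed

context
  fixes A :: "('g, 'x) gaction"
  assumes A: "perm_group_action A"
begin

interpretation subgroup "perms A" "BijGroup (pts A)"
  using subgroup_perms[OF A] .

lemma perms_Bij: "k \<in> perms A \<Longrightarrow> k \<in> Bij (pts A)"
  using subset by (auto simp: BijGroup_simps)

lemma perms_bij: "k \<in> perms A \<Longrightarrow> bij_betw k (pts A) (pts A)"
  using perms_Bij Bij_bij_betw by blast

lemma perms_closed: "k \<in> perms A \<Longrightarrow> x \<in> pts A \<Longrightarrow> k x \<in> pts A"
  using perms_bij bij_betwE by blast

lemma perms_one: "(\<lambda>x\<in>pts A. x) \<in> perms A"
  using one_closed by (simp add: BijGroup_simps)

lemma perms_compose: "k \<in> perms A \<Longrightarrow> l \<in> perms A \<Longrightarrow> compose (pts A) k l \<in> perms A"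
  using m_closed by (simp add: BijGroup_simps perms_Bij)

lemma perms_inverse:
  assumes "k \<in> perms A"
  obtains l where "l \<in> perms A" "\<And>x. x \<in> pts A \<Longrightarrow> l (k x) = x" "\<And>x. x \<in> pts A \<Longrightarrow> k (l x) = x"
proof
  show "restrict (inv_into (pts A) k) (pts A) \<in> perms A"
    using m_inv_closed[OF assms] by (simp add: inv_BijGroup perms_Bij assms)
  show "k (restrict (inv_into (pts A) k) (pts A) x) = x" if "x \<in> pts A" for x
    using perms_bij[OF assms] that by (simp add: bij_betw_def f_inv_into_f)
qed (use perms_bij[OF assms] in \<open>auto simp: bij_betw_def\<close>)

end

text \<open>An embedding identifies the arc group with the full induced group. Here every element is
  seen to act as the restriction of some element of the larger group; the companion lemma below uses
  that all such restrictions are reached.\<close>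

lemma embedding_perms_lift:
  assumes "embedding \<Phi> B A" "\<tau> \<in> perms B"
  shows "\<exists>k\<in>perms A. \<forall>y\<in>pts B. k (\<Phi> y) = \<Phi> (\<tau> y)"
proof -
  let ?e = "\<lambda>h. \<lambda>x\<in>\<Phi> ` pts B. \<Phi> (act B h (inv_into (pts B) \<Phi> x))"
  have inj: "inj_on \<Phi> (pts B)" and im: "?e ` carrier (grp B) = carrier (induced_group A (\<Phi> ` pts B))"
    using assms(1) unfolding embedding_def iso_def bij_betw_def by auto
  obtain h where h: "h \<in> carrier (grp B)" "\<tau> = act B h"
    using assms(2) unfolding perms_def by blast
  then have "?e h \<in> carrier (induced_group A (\<Phi> ` pts B))"
    using im by blast
  then obtain k where k: "k \<in> perms A" "?e h = restrict k (\<Phi> ` pts B)"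
    unfolding induced_group_def by auto
  have "k (\<Phi> y) = \<Phi> (\<tau> y)" if "y \<in> pts B" for y
    using fun_cong[OF k(2), of "\<Phi> y"] that inj h(2) by simp
  then show ?thesis
    using k(1) by blast
qed

lemma embedding_perms_restrict:
  assumes "embedding \<Phi> B A" "k \<in> perms A" "k ` \<Phi> ` pts B = \<Phi> ` pts B"
  shows "\<exists>\<tau>\<in>perms B. \<forall>y\<in>pts B. k (\<Phi> y) = \<Phi> (\<tau> y)"
proof -
  let ?e = "\<lambda>h. \<lambda>x\<in>\<Phi> ` pts B. \<Phi> (act B h (inv_into (pts B) \<Phi> x))"
  have inj: "inj_on \<Phi> (pts B)" and im: "?e ` carrier (grp B) = carrier (induced_group A (\<Phi> ` pts B))"
    using assms(1) unfolding embedding_def iso_def bij_betw_def by auto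
  have "restrict k (\<Phi> ` pts B) \<in> carrier (induced_group A (\<Phi> ` pts B))"
    unfolding induced_group_def using assms(2,3) by auto
  then obtain h where h: "h \<in> carrier (grp B)" "?e h = restrict k (\<Phi> ` pts B)"
    using im by (metis (no_types, lifting) imageE)
  have "k (\<Phi> y) = \<Phi> (act B h y)" if "y \<in> pts B" for y
    using fun_cong[OF h(2), of "\<Phi> y"] that inj by simp
  then show ?thesis
    using h(1) unfolding perms_def by blast
qed

section \<open>Twisting by inversion agents\<close>

text \<open>The first equation forces \<tau> to be \<eta>^-1 \<theta> \<eta>', and the second then
  forces \<theta>' to be \<zeta> \<tau> \<zeta>'^-1. In each of the four cases this is a conjugate
  of \<theta> by \<open>h\<close> or its inverse, multiplied by the square of \<open>h\<close> or
  the inverse of that square when the twisted side changes. Both factors lie in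
  \<open>N\<close>.\<close>

lemma (in group) twist_transfer_group:
  assumes N: "subgroup N G" and h: "h \<in> carrier G" "h <# N #> inv h = N" "h \<otimes> h \<in> N"
    and e: "(\<eta>, \<zeta>) \<in> {(\<one>, h), (h, \<one>)}" "(\<eta>', \<zeta>') \<in> {(\<one>, h), (h, \<one>)}" and \<theta>: "\<theta> \<in> N"
  shows "\<exists>\<tau>\<in>carrier G. \<exists>\<theta>'\<in>N. \<eta> \<otimes> \<tau> = \<theta> \<otimes> \<eta>' \<and> \<zeta> \<otimes> \<tau> = \<theta>' \<otimes> \<zeta>'"
proof -
  have \<theta>G: "\<theta> \<in> carrier G"
    using N \<theta> subgroup.mem_carrier by fast
  have conj: "h \<otimes> \<theta> \<otimes> inv h \<in> N"
    using h(2) \<theta> unfolding l_coset_def r_coset_def by blast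
  have "\<theta> \<in> h <# N #> inv h"
    using h(2) \<theta> by simp
  \<comment> \<open>\<open>n\<close> is the conjugate of \<theta> by the inverse of
    \<open>h\<close>; the equality of \<open>h N h^-1\<close> with \<open>N\<close> gives it as an
    element of \<open>N\<close>.\<close>
  then obtain n where n: "n \<in> N" "\<theta> = h \<otimes> n \<otimes> inv h"
    unfolding l_coset_def r_coset_def by blast
  have nG: "n \<in> carrier G"
    using N n(1) subgroup.mem_carrier by fast
  have nh: "h \<otimes> n = \<theta> \<otimes> h"
    using n(2) nG h(1) by (simp add: m_assoc)
  have N1: "(h \<otimes> \<theta> \<otimes> inv h) \<otimes> (h \<otimes> h) \<in> N"
    using conj h(3) subgroup.m_closed[OF N] by blast
  have N2: "n \<otimes> inv (h \<otimes> h) \<in> N"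
    using n(1) h(3) subgroup.m_closed[OF N] subgroup.m_inv_closed[OF N] by blast
  have "h \<otimes> \<theta> = (h \<otimes> \<theta> \<otimes> inv h) \<otimes> h"
    using \<theta>G h(1) by (simp add: m_assoc)
  moreover have "h \<otimes> (\<theta> \<otimes> h) = (h \<otimes> \<theta> \<otimes> inv h) \<otimes> (h \<otimes> h)"
  proof -
    have "inv h \<otimes> (h \<otimes> h) = h"
      using h(1) by (simp flip: m_assoc)
    then show ?thesis
      using \<theta>G h(1) by (simp add: m_assoc)
  qed
  moreover have "n \<otimes> inv h = (n \<otimes> inv (h \<otimes> h)) \<otimes> h"
    using nG h(1) by (simp add: m_assoc inv_mult_group)
  moreover have "h \<otimes> (n \<otimes> inv h) = \<theta>"
    using n(2) nG h(1) by (simp add: m_assoc)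
  ultimately have eqs:
    "\<one> \<otimes> \<theta> = \<theta> \<otimes> \<one> \<and> h \<otimes> \<theta> = (h \<otimes> \<theta> \<otimes> inv h) \<otimes> h"
    "\<one> \<otimes> (\<theta> \<otimes> h) = \<theta> \<otimes> h \<and> h \<otimes> (\<theta> \<otimes> h) = ((h \<otimes> \<theta> \<otimes> inv h) \<otimes> (h \<otimes> h)) \<otimes> \<one>"
    "h \<otimes> (n \<otimes> inv h) = \<theta> \<otimes> \<one> \<and> \<one> \<otimes> (n \<otimes> inv h) = (n \<otimes> inv (h \<otimes> h)) \<otimes> h"
    "h \<otimes> n = \<theta> \<otimes> h \<and> \<one> \<otimes> n = n \<otimes> \<one>"
    using \<theta>G nG nh h(1) by (simp_all only: m_closed inv_closed l_one r_one)
  have G: "\<theta> \<in> carrier G" "\<theta> \<otimes> h \<in> carrier G" "n \<otimes> inv h \<in> carrier G" "n \<in> carrier G"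
    using \<theta>G nG h(1) by simp_all
  consider "\<eta> = \<one>" "\<zeta> = h" "\<eta>' = \<one>" "\<zeta>' = h" | "\<eta> = \<one>" "\<zeta> = h" "\<eta>' = h" "\<zeta>' = \<one>"
    | "\<eta> = h" "\<zeta> = \<one>" "\<eta>' = \<one>" "\<zeta>' = h" | "\<eta> = h" "\<zeta> = \<one>" "\<eta>' = h" "\<zeta>' = \<one>"
    using e by blast
  then show ?thesis
  proof cases
    case 1
    show ?thesis unfolding 1 using eqs(1) G(1) conj by blast
  next
    case 2
    show ?thesis unfolding 2 using eqs(2) G(2) N1 by blast
  next
    case 3
    show ?thesis unfolding 3 using eqs(3) G(3) N2 by blast
  next
    case 4
    show ?thesis unfolding 4 using eqs(4) G(4) n(1) by blast
  qed
qed

text \<open>For a self-reverse arc exactly one of the two bundle maps of an arc and its reverse is twisted;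
  the pairs record the permutations with which these maps precede the embeddings.\<close>

definition twists :: "('v, 'a, 'g, 'x, 'h, 'y) gga \<Rightarrow> 'a \<Rightarrow> (('y \<Rightarrow> 'y) \<times> ('y \<Rightarrow> 'y)) set" where
  "twists \<G> a = (let e = (\<lambda>y\<in>pts (aact \<G> a). y) in
     if self_reverse \<G> a then {(e, agent \<G> a), (agent \<G> a, e)} else {(e, e)})"

context
  fixes \<G> :: "('v, 'a, 'g, 'x, 'h, 'y) gga" and a
  assumes \<G>: "graph_of_group_actions \<G>" and a: "a \<in> arcs (base \<G>)"
begin

lemma gga_arc:
  "perm_group_action (aact \<G> a)" "perm_group_action (vact \<G> (terminus (base \<G>) a))"
  "aact \<G> (arev (base \<G>) a) = aact \<G> a"
  "embedding (emb \<G> a) (aact \<G> a) (vact \<G> (terminus (base \<G>) a))"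
  "self_reverse \<G> a \<Longrightarrow> inversion_agent (aact \<G> a) (agent \<G> a)"
  "arev (base \<G>) a \<in> arcs (base \<G>)" "terminus (base \<G>) (arev (base \<G>) a) = origin (base \<G>) a"
  using \<G> a unfolding graph_of_group_actions_def graph_def by auto

lemma twists_Bij:
  assumes "(\<eta>, \<zeta>) \<in> twists \<G> a"
  shows "\<eta> \<in> Bij (pts (aact \<G> a))" "\<zeta> \<in> Bij (pts (aact \<G> a))"
  using assms gga_arc(5) id_Bij[of "pts (aact \<G> a)"]
  by (auto simp: twists_def Let_def inversion_agent_def BijGroup_simps split: if_splits)

text \<open>Without self-reversal all twists are identities and \<theta> itself serves as both
  permutations. Otherwise \<tau> may leave the arc group when the twisted side changes, so it is
  only claimed to be a permutation of the colours; what matters is that \<theta>' stays in the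
  group.\<close>

lemma twist_transfer:
  assumes e: "(\<eta>, \<zeta>) \<in> twists \<G> a" "(\<eta>', \<zeta>') \<in> twists \<G> a" and \<theta>: "\<theta> \<in> perms (aact \<G> a)"
  shows "\<exists>\<tau>\<in>Bij (pts (aact \<G> a)). \<exists>\<theta>'\<in>perms (aact \<G> a).
    \<forall>y\<in>pts (aact \<G> a). \<eta> (\<tau> y) = \<theta> (\<eta>' y) \<and> \<zeta> (\<tau> y) = \<theta>' (\<zeta>' y)"
proof -
  let ?Y = "pts (aact \<G> a)"
  interpret group "BijGroup ?Y" by (rule group_BijGroup)
  have B: "\<theta>' \<in> Bij ?Y" if "\<theta>' \<in> perms (aact \<G> a)" for \<theta>'
    using perms_Bij[OF gga_arc(1) that] .
  have "\<exists>\<tau>\<in>Bij ?Y. \<exists>\<theta>'\<in>perms (aact \<G> a).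
      compose ?Y \<eta> \<tau> = compose ?Y \<theta> \<eta>' \<and> compose ?Y \<zeta> \<tau> = compose ?Y \<theta>' \<zeta>'"
  proof (cases "self_reverse \<G> a")
    case True
    have "\<exists>\<tau>\<in>carrier (BijGroup ?Y). \<exists>\<theta>'\<in>perms (aact \<G> a).
        \<eta> \<otimes>\<^bsub>BijGroup ?Y\<^esub> \<tau> = \<theta> \<otimes>\<^bsub>BijGroup ?Y\<^esub> \<eta>' \<and> \<zeta> \<otimes>\<^bsub>BijGroup ?Y\<^esub> \<tau> = \<theta>' \<otimes>\<^bsub>BijGroup ?Y\<^esub> \<zeta>'"
    proof (rule twist_transfer_group[OF subgroup_perms[OF gga_arc(1)]])
      show "agent \<G> a \<in> carrier (BijGroup ?Y)"
        "agent \<G> a <#\<^bsub>BijGroup ?Y\<^esub> perms (aact \<G> a) #>\<^bsub>BijGroup ?Y\<^esub> inv\<^bsub>BijGroup ?Y\<^esub> agent \<G> a = perms (aact \<G> a)"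
        "agent \<G> a \<otimes>\<^bsub>BijGroup ?Y\<^esub> agent \<G> a \<in> perms (aact \<G> a)"
        using gga_arc(5)[OF True] by (simp_all only: inversion_agent_def Let_def)
      show "(\<eta>, \<zeta>) \<in> {(\<one>\<^bsub>BijGroup ?Y\<^esub>, agent \<G> a), (agent \<G> a, \<one>\<^bsub>BijGroup ?Y\<^esub>)}"
        "(\<eta>', \<zeta>') \<in> {(\<one>\<^bsub>BijGroup ?Y\<^esub>, agent \<G> a), (agent \<G> a, \<one>\<^bsub>BijGroup ?Y\<^esub>)}"
        using e unfolding twists_def Let_def BijGroup_simps if_P[OF True] .
    qed (rule \<theta>)
    then show ?thesis
      using twists_Bij[OF e(1)] twists_Bij[OF e(2)] B \<theta> by (auto simp: BijGroup_simps)
  next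
    case False
    then have "\<eta> = (\<lambda>y\<in>?Y. y)" "\<zeta> = (\<lambda>y\<in>?Y. y)" "\<eta>' = (\<lambda>y\<in>?Y. y)" "\<zeta>' = (\<lambda>y\<in>?Y. y)"
      using e by (auto simp: twists_def Let_def)
    then show ?thesis
      using Bij_imp_extensional[OF B[OF \<theta>]] Bij_imp_funcset[OF B[OF \<theta>]] B[OF \<theta>] \<theta>
      by (intro bexI[of _ \<theta>]) (auto simp: compose_def restrict_def extensional_def fun_eq_iff Pi_iff)
  qed
  then obtain \<tau> \<theta>' where "\<tau> \<in> Bij ?Y" "\<theta>' \<in> perms (aact \<G> a)"
    and *: "compose ?Y \<eta> \<tau> = compose ?Y \<theta> \<eta>'" "compose ?Y \<zeta> \<tau> = compose ?Y \<theta>' \<zeta>'" by blast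
  moreover have "\<eta> (\<tau> y) = \<theta> (\<eta>' y) \<and> \<zeta> (\<tau> y) = \<theta>' (\<zeta>' y)" if "y \<in> ?Y" for y
    using fun_cong[OF *(1), of y] fun_cong[OF *(2), of y] that by (simp add: compose_eq)
  ultimately show ?thesis
    by blast
qed

end

section \<open>Scaffoldings\<close>

text \<open>No colouring is fixed here, because two legal colourings over the same graph,
  equivalence relation and projection are to be compared.\<close>

locale scaffold =
  fixes \<G> :: "('v, 'a, 'g, 'x, 'h, 'y) gga"
    and S :: "('sv, 'sa) rgraph"
    and r :: "('sv \<times> 'sv) set"
    and \<pi> :: "('sv set \<Rightarrow> 'v) \<times> ('sa set \<Rightarrow> 'a)"
  assumes gga: "graph_of_group_actions \<G>"
    and graph_S: "graph S"
    and equiv_r: "equiv (verts S) r"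
    and tree_T: "tree (quotient_graph S r)"
    and morphism_\<pi>: "graph_morphism (quotient_graph S r) (base \<G>) \<pi>"
begin

abbreviation T :: "('sv set, 'sa set) rgraph" where "T \<equiv> quotient_graph S r"
abbreviation vbundle :: "'sv \<Rightarrow> 'sv set" where "vbundle x \<equiv> r `` {x}"
abbreviation abundle :: "'sa \<Rightarrow> 'sa set" where "abundle b \<equiv> arc_rel S r `` {b}"
abbreviation legal :: "('sv \<Rightarrow> 'x) \<times> ('sa \<Rightarrow> 'y) \<Rightarrow> bool" where "legal \<equiv> legal_colouring \<G> S r \<pi>"
abbreviation X :: "'v \<Rightarrow> 'x set" where "X v \<equiv> pts (vact \<G> v)"
abbreviation Y :: "'a \<Rightarrow> 'y set" where "Y a \<equiv> pts (aact \<G> a)"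
abbreviation Grp :: "'v \<Rightarrow> ('x \<Rightarrow> 'x) set" where "Grp v \<equiv> perms (vact \<G> v)"

lemma S_arc:
  assumes "b \<in> arcs S"
  shows "origin S b \<in> verts S" "terminus S b \<in> verts S" "arev S b \<in> arcs S"
    "arev S (arev S b) = b" "origin S (arev S b) = terminus S b" "terminus S (arev S b) = origin S b"
  using graph_S assms unfolding graph_def by metis+

lemma r_verts: "(x, y) \<in> r \<Longrightarrow> x \<in> verts S \<and> y \<in> verts S"
  using equiv_type[OF equiv_r] by auto

lemma r_refl: "x \<in> verts S \<Longrightarrow> (x, x) \<in> r"
  using equiv_r by (meson equivE refl_onD)

lemma vbundle_eq_iff: "x \<in> verts S \<Longrightarrow> y \<in> verts S \<Longrightarrow> vbundle x = vbundle y \<longleftrightarrow> (x, y) \<in> r"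
  using eq_equiv_class_iff[OF equiv_r] .

lemma vert_T_iff: "V \<in> verts T \<longleftrightarrow> (\<exists>x\<in>verts S. V = vbundle x)"
  by (auto simp: quotient_graph_def quotient_def)

lemma vert_T_bundle: "V \<in> verts T \<Longrightarrow> x \<in> V \<Longrightarrow> x \<in> verts S \<and> V = vbundle x"
  unfolding vert_T_iff using r_verts vbundle_eq_iff by blast

lemma arc_rel_iff: "(b, c) \<in> arc_rel S r \<longleftrightarrow> b \<in> arcs S \<and> c \<in> arcs S \<and>
    vbundle (origin S b) = vbundle (origin S c) \<and> vbundle (terminus S b) = vbundle (terminus S c)"
  by (simp add: arc_rel_def) (metis S_arc(1,2) vbundle_eq_iff)

lemma abundle_eq: "b \<in> arcs S \<Longrightarrow> abundle b = {c \<in> arcs S.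
    vbundle (origin S c) = vbundle (origin S b) \<and> vbundle (terminus S c) = vbundle (terminus S b)}"
  by (auto simp: arc_rel_iff)

lemma arc_T_iff: "A \<in> arcs T \<longleftrightarrow> (\<exists>b\<in>arcs S. A = abundle b)"
  by (auto simp: quotient_graph_def quotient_def)

lemma arc_T_bundle: "A \<in> arcs T \<Longrightarrow> b \<in> A \<Longrightarrow> b \<in> arcs S \<and> A = abundle b"
  unfolding arc_T_iff by (auto simp: arc_rel_iff)

lemma arc_T_nonempty: "A \<in> arcs T \<Longrightarrow> \<exists>b. b \<in> A"
  unfolding arc_T_iff by (auto simp: arc_rel_iff)

text \<open>The end of a bundle is a union of vertex classes, one for each arc in the bundle; they
  all coincide by the definition of \<open>arc_rel\<close>.\<close>

lemma T_arc:
  assumes b: "b \<in> arcs S"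
  shows "origin T (abundle b) = vbundle (origin S b)"
    and "terminus T (abundle b) = vbundle (terminus S b)"
    and "arev T (abundle b) = abundle (arev S b)"
proof -
  have "r `` (f ` abundle b) = vbundle (f b)"
    if "\<And>c. c \<in> abundle b \<Longrightarrow> vbundle (f c) = vbundle (f b)" for f
  proof -
    have "r `` (f ` abundle b) = (\<Union>c\<in>abundle b. vbundle (f c))" by blast
    also have "\<dots> = (\<Union>c\<in>abundle b. vbundle (f b))" using that by simp
    also have "\<dots> = vbundle (f b)" using b by (auto simp: arc_rel_iff)
    finally show ?thesis .
  qed
  then show "origin T (abundle b) = vbundle (origin S b)"
    "terminus T (abundle b) = vbundle (terminus S b)"
    by (simp_all add: quotient_graph_def arc_rel_iff)
  have "arev S c \<in> abundle (arev S b)" if "c \<in> abundle b" for c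
    using that S_arc b by (auto simp: arc_rel_iff)
  moreover have "c \<in> arev S ` abundle b" if "c \<in> abundle (arev S b)" for c
  proof (rule image_eqI)
    show "c = arev S (arev S c)" "arev S c \<in> abundle b"
      using that S_arc b by (auto simp: arc_rel_iff)
  qed
  ultimately show "arev T (abundle b) = abundle (arev S b)"
    by (auto simp: quotient_graph_def)
qed

lemma adj_T_iff: "(V, W) \<in> adj T \<longleftrightarrow>
    (\<exists>b\<in>arcs S. V = vbundle (origin S b) \<and> W = vbundle (terminus S b))"
  unfolding adj_def using T_arc(1,2) arc_T_iff by (smt (verit) mem_Collect_eq prod.inject)

lemma \<pi>_arc:
  assumes "b \<in> arcs S"
  shows "amap \<pi> (abundle b) \<in> arcs (base \<G>)"
    "origin (base \<G>) (amap \<pi> (abundle b)) = vmap \<pi> (vbundle (origin S b))"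
    "terminus (base \<G>) (amap \<pi> (abundle b)) = vmap \<pi> (vbundle (terminus S b))"
    "arev (base \<G>) (amap \<pi> (abundle b)) = amap \<pi> (abundle (arev S b))"
proof -
  have A: "abundle b \<in> arcs T"
    using assms by (auto simp: arc_T_iff)
  then show "amap \<pi> (abundle b) \<in> arcs (base \<G>)"
    using morphism_\<pi> unfolding graph_morphism_def by blast
  show "origin (base \<G>) (amap \<pi> (abundle b)) = vmap \<pi> (vbundle (origin S b))"
    "terminus (base \<G>) (amap \<pi> (abundle b)) = vmap \<pi> (vbundle (terminus S b))"
    "arev (base \<G>) (amap \<pi> (abundle b)) = amap \<pi> (abundle (arev S b))"
    using morphism_\<pi> A unfolding graph_morphism_def T_arc[OF assms, symmetric] by blast+
qed

lemma vact_\<pi>: "V \<in> verts T \<Longrightarrow> perm_group_action (vact \<G> (vmap \<pi> V))"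
  using gga morphism_\<pi> unfolding graph_of_group_actions_def graph_morphism_def by blast

section \<open>Consequences of legality of a colouring\<close>

lemma legal_bij:
  assumes "legal p"
  shows "V \<in> verts T \<Longrightarrow> bij_betw (vmap p) V (X (vmap \<pi> V))"
    and "A \<in> arcs T \<Longrightarrow> bij_betw (amap p) A (Y (amap \<pi> A))"
    and "b \<in> arcs S \<Longrightarrow> amap p (arev S b) = amap p b"
proof -
  have "(\<forall>V\<in>verts T. bij_betw (vmap p) V (X (vmap \<pi> V))) \<and>
      (\<forall>A\<in>arcs T. bij_betw (amap p) A (Y (amap \<pi> A))) \<and> (\<forall>b\<in>arcs S. amap p (arev S b) = amap p b)"
    using assms unfolding legal_colouring_def Let_def by (elim conjE) (intro conjI)
  then show "V \<in> verts T \<Longrightarrow> bij_betw (vmap p) V (X (vmap \<pi> V))"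
    "A \<in> arcs T \<Longrightarrow> bij_betw (amap p) A (Y (amap \<pi> A))"
    "b \<in> arcs S \<Longrightarrow> amap p (arev S b) = amap p b" by blast+
qed

text \<open>The definite description is resolved by bijectivity of the colouring on the arc bundle:
  each colour belongs to one arc, which fixes the value there, and extensionality fixes it
  elsewhere.\<close>

lemma bundle_map_apply:
  assumes p: "legal p" and A: "A \<in> arcs T" and b: "b \<in> A"
  shows "bundle_map \<G> S r \<pi> p A (amap p b) = vmap p (terminus S b)"
proof -
  let ?Y = "Y (amap \<pi> A)" and ?V = "terminus T A"
  have A': "c \<in> arcs S" "A = abundle c" "?V = vbundle (terminus S c)" if "c \<in> A" for c
    using arc_T_bundle[OF A that] T_arc(2) by auto
  have V: "?V \<in> verts T"
    unfolding A'(3)[OF b] vert_T_iff using S_arc(2) A'(1)[OF b] by blast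
  have bij: "bij_betw (amap p) A ?Y" and bijV: "bij_betw (vmap p) ?V (X (vmap \<pi> ?V))"
    using legal_bij[OF p] A V by auto
  let ?\<psi> = "\<lambda>y\<in>?Y. vmap p (terminus S (inv_into A (amap p) y))"
  have "\<exists>!\<psi>. \<psi> \<in> ?Y \<rightarrow>\<^sub>E X (vmap \<pi> ?V) \<and> (\<forall>b\<in>A. \<psi> (amap p b) = vmap p (terminus S b))"
  proof (rule ex1I[of _ ?\<psi>], intro conjI ballI)
    show "?\<psi> \<in> ?Y \<rightarrow>\<^sub>E X (vmap \<pi> ?V)"
    proof (rule restrict_PiE_iff[THEN iffD2], rule ballI)
      fix y assume "y \<in> ?Y"
      then have c: "inv_into A (amap p) y \<in> A"
        using bij by (metis bij_betw_def inv_into_into)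
      then have "terminus S (inv_into A (amap p) y) \<in> ?V"
        unfolding A'(3)[OF c] using A'(1)[OF c] S_arc(2) r_refl by blast
      then show "vmap p (terminus S (inv_into A (amap p) y)) \<in> X (vmap \<pi> ?V)"
        using bijV bij_betwE by blast
    qed
    show "?\<psi> (amap p c) = vmap p (terminus S c)" if "c \<in> A" for c
      using bij that by (auto simp: bij_betw_def)
  next
    fix \<psi> assume \<psi>: "\<psi> \<in> ?Y \<rightarrow>\<^sub>E X (vmap \<pi> ?V) \<and> (\<forall>b\<in>A. \<psi> (amap p b) = vmap p (terminus S b))"
    show "\<psi> = ?\<psi>"
    proof
      fix y
      show "\<psi> y = ?\<psi> y"
      proof (cases "y \<in> ?Y")
        case True
        then have "inv_into A (amap p) y \<in> A" "amap p (inv_into A (amap p) y) = y"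
          using bij by (metis bij_betw_def inv_into_into, metis bij_betw_def f_inv_into_f)
        then show ?thesis
          using \<psi> True by (metis restrict_apply')
      next
        case False
        then show ?thesis using \<psi> by (auto simp: PiE_def extensional_def)
      qed
    qed
  qed
  from theI'[OF this] show ?thesis
    unfolding bundle_map_def using b by blast
qed

text \<open>A normal form for both ends at once: the colour of an end is an arc colour, twisted,
  embedded and moved by the vertex group. The cases of adhesion and twisted adhesion maps are
  absorbed into the pair from \<open>twists\<close>.\<close>

lemma legal_twists:
  assumes p: "legal p" and A: "A \<in> arcs T" and a: "amap \<pi> A = a"
  shows "\<exists>\<eta> \<zeta> k m. (\<eta>, \<zeta>) \<in> twists \<G> a \<and>
    k \<in> Grp (terminus (base \<G>) a) \<and> m \<in> Grp (terminus (base \<G>) (arev (base \<G>) a)) \<and>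
    (\<forall>b\<in>A. vmap p (terminus S b) = k (emb \<G> a (\<eta> (amap p b)))) \<and>
    (\<forall>b\<in>A. vmap p (origin S b) = m (emb \<G> (arev (base \<G>) a) (\<zeta> (amap p b))))"
proof -
  let ?\<Psi> = "bundle_map \<G> S r \<pi> p" and ?e = "\<lambda>y\<in>Y a. y" and ?a' = "arev (base \<G>) a"
  have c: "c \<in> arcs S" "A = abundle c" if "c \<in> A" for c
    using arc_T_bundle[OF A that] by auto
  obtain c where "c \<in> A" using arc_T_nonempty[OF A] by blast
  note c0 = c[OF this]
  have A': "arev T A \<in> arcs T"
    using c0 T_arc(3) S_arc(3) by (auto simp: arc_T_iff)
  have a': "amap \<pi> (arev T A) = ?a'" and aT: "a \<in> arcs (base \<G>)"
    using \<pi>_arc(1,4)[OF c0(1)] c0 a T_arc(3) by auto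
  have YA: "amap p b \<in> Y a" if "b \<in> A" for b
    using legal_bij(2)[OF p A] that a bij_betwE by blast
  have t: "?\<Psi> A (amap p b) = vmap p (terminus S b)" if "b \<in> A" for b
    using bundle_map_apply[OF p A that] .
  \<comment> \<open>An arc and its reverse have the same colour, so origins are seen through the
    bundle map of the reverse bundle.\<close>
  have o: "?\<Psi> (arev T A) (amap p b) = vmap p (origin S b)" if "b \<in> A" for b
  proof -
    have "arev S b \<in> arev T A"
      using that by (simp add: quotient_graph_def)
    then show ?thesis
      using bundle_map_apply[OF p A', of "arev S b"] legal_bij(3)[OF p] S_arc(6) c(1)[OF that] by simp
  qed
  have adh: "\<exists>k\<in>Grp (terminus (base \<G>) d). \<forall>y\<in>Y d. \<psi> y = k (emb \<G> d (?e y))"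
    if "\<psi> \<in> adhesion_maps \<G> d" "Y d = Y a" for \<psi> d
    using that unfolding adhesion_maps_def by (auto simp: compose_eq)
  have tw: "\<exists>k\<in>Grp (terminus (base \<G>) d). \<forall>y\<in>Y d. \<psi> y = k (emb \<G> d (agent \<G> d y))"
    if "\<psi> \<in> twisted_adhesion_maps \<G> d" for \<psi> d
    using that unfolding twisted_adhesion_maps_def by (auto simp: compose_eq)
  have Ya: "Y ?a' = Y a"
    using gga_arc(3)[OF gga aT] by simp
  have "\<forall>A\<in>arcs T. if self_reverse \<G> (amap \<pi> A)
           then (?\<Psi> A \<in> adhesion_maps \<G> (amap \<pi> A) \<and> ?\<Psi> (arev T A) \<in> twisted_adhesion_maps \<G> (amap \<pi> A)) \<or>
                (?\<Psi> A \<in> twisted_adhesion_maps \<G> (amap \<pi> A) \<and> ?\<Psi> (arev T A) \<in> adhesion_maps \<G> (amap \<pi> A))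
           else ?\<Psi> A \<in> adhesion_maps \<G> (amap \<pi> A)"
    using p unfolding legal_colouring_def Let_def by (elim conjE)
  note L = this[rule_format]
  have "\<exists>\<eta> \<zeta>. (\<eta>, \<zeta>) \<in> twists \<G> a \<and>
    (\<exists>k\<in>Grp (terminus (base \<G>) a). \<forall>y\<in>Y a. ?\<Psi> A y = k (emb \<G> a (\<eta> y))) \<and>
    (\<exists>m\<in>Grp (terminus (base \<G>) ?a'). \<forall>y\<in>Y a. ?\<Psi> (arev T A) y = m (emb \<G> ?a' (\<zeta> y)))"
  proof (cases "self_reverse \<G> a")
    case True
    then have "(?\<Psi> A \<in> adhesion_maps \<G> a \<and> ?\<Psi> (arev T A) \<in> twisted_adhesion_maps \<G> a) \<or>
                (?\<Psi> A \<in> twisted_adhesion_maps \<G> a \<and> ?\<Psi> (arev T A) \<in> adhesion_maps \<G> a)"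
      using L[OF A] a by simp
    then show ?thesis
    proof
      assume *: "?\<Psi> A \<in> adhesion_maps \<G> a \<and> ?\<Psi> (arev T A) \<in> twisted_adhesion_maps \<G> a"
      have "(?e, agent \<G> a) \<in> twists \<G> a" using True by (simp add: twists_def Let_def)
      then show ?thesis
        using adh[of _ a] tw[of _ a] * True by metis
    next
      assume *: "?\<Psi> A \<in> twisted_adhesion_maps \<G> a \<and> ?\<Psi> (arev T A) \<in> adhesion_maps \<G> a"
      have "(agent \<G> a, ?e) \<in> twists \<G> a" using True by (simp add: twists_def Let_def)
      then show ?thesis
        using adh[of _ a] tw[of _ a] * True by metis
    qed
  next
    case False
    \<comment> \<open>The reverse arc is not self-reverse either, so legality applies to the bundle
      and to its reverse separately.\<close>
    then have F': "arev (base \<G>) ?a' \<noteq> ?a'"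
      using gga aT unfolding graph_of_group_actions_def graph_def by metis
    have "(?e, ?e) \<in> twists \<G> a" using False by (simp add: twists_def Let_def)
    moreover have "?\<Psi> A \<in> adhesion_maps \<G> a" "?\<Psi> (arev T A) \<in> adhesion_maps \<G> ?a'"
      using L[OF A] L[OF A'] a a' False F' by auto
    ultimately show ?thesis
      using adh[of "?\<Psi> A" a] adh[of "?\<Psi> (arev T A)" ?a'] Ya by metis
  qed
  then obtain \<eta> \<zeta> k m where *: "(\<eta>, \<zeta>) \<in> twists \<G> a"
    "k \<in> Grp (terminus (base \<G>) a)" "m \<in> Grp (terminus (base \<G>) ?a')"
    "\<And>y. y \<in> Y a \<Longrightarrow> ?\<Psi> A y = k (emb \<G> a (\<eta> y))"
    "\<And>y. y \<in> Y a \<Longrightarrow> ?\<Psi> (arev T A) y = m (emb \<G> ?a' (\<zeta> y))" by blast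
  then show ?thesis
    using YA t o by (intro exI[of _ \<eta>] exI[of _ \<zeta>] exI[of _ k] exI[of _ m]) simp
qed

text \<open>Twists permute the colours in \<open>Y a\<close> and so do not change the image. Hence
  adhesion sets do not reveal which side of a self-reverse arc is twisted.\<close>

lemma legal_terminus_image:
  assumes p: "legal p" and A: "A \<in> arcs T" and a: "amap \<pi> A = a"
  shows "(\<lambda>b. vmap p (terminus S b)) ` A \<in> adhesion_sets \<G> a"
proof -
  obtain \<eta> \<zeta> k m where *: "(\<eta>, \<zeta>) \<in> twists \<G> a" "k \<in> Grp (terminus (base \<G>) a)"
    and "m \<in> Grp (terminus (base \<G>) (arev (base \<G>) a))"
    and **: "\<And>b. b \<in> A \<Longrightarrow> vmap p (terminus S b) = k (emb \<G> a (\<eta> (amap p b)))"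
    and "\<And>b. b \<in> A \<Longrightarrow> vmap p (origin S b) = m (emb \<G> (arev (base \<G>) a) (\<zeta> (amap p b)))"
    using legal_twists[OF p A a] by blast
  have aT: "a \<in> arcs (base \<G>)"
    using A a \<pi>_arc(1) by (auto simp: arc_T_iff)
  have "\<eta> ` amap p ` A = Y a"
    using legal_bij(2)[OF p A] Bij_bij_betw[OF twists_Bij(1)[OF gga aT *(1)]] a
    by (simp add: bij_betw_def)
  moreover have "k ` emb \<G> a ` \<eta> ` amap p ` A = (\<lambda>b. vmap p (terminus S b)) ` A"
    using ** by (simp add: image_image)
  moreover have "k ` emb \<G> a ` Y a = compose (Y a) k (emb \<G> a) ` Y a"
    by (auto simp: compose_eq)
  ultimately have "(\<lambda>b. vmap p (terminus S b)) ` A = compose (Y a) k (emb \<G> a) ` Y a"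
    by simp
  then show ?thesis
    unfolding adhesion_sets_def adhesion_maps_def using *(2) by blast
qed

lemma adhesion_sets_image:
  assumes a: "a \<in> arcs (base \<G>)" and \<sigma>: "\<sigma> \<in> Grp (terminus (base \<G>) a)" and Z: "Z \<in> adhesion_sets \<G> a"
  shows "\<sigma> ` Z \<in> adhesion_sets \<G> a"
proof -
  obtain k where k: "k \<in> Grp (terminus (base \<G>) a)" "Z = compose (Y a) k (emb \<G> a) ` Y a"
    using Z unfolding adhesion_sets_def adhesion_maps_def by auto
  let ?l = "compose (X (terminus (base \<G>) a)) \<sigma> k"
  have "emb \<G> a y \<in> X (terminus (base \<G>) a)" if "y \<in> Y a" for y
    using gga_arc(4)[OF gga a] that unfolding embedding_def by blast
  then have "\<sigma> ` Z = compose (Y a) ?l (emb \<G> a) ` Y a"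
    unfolding k(2) by (auto simp: compose_eq image_image)
  moreover have "?l \<in> Grp (terminus (base \<G>) a)"
    using perms_compose[OF gga_arc(2)[OF gga a] \<sigma> k(1)] .
  ultimately show ?thesis
    unfolding adhesion_sets_def adhesion_maps_def by blast
qed

text \<open>The existence and uniqueness clause of legality, freed of the bundle map: the colours of
  the termini replace its image.\<close>

lemma legal_adhesion_arc:
  assumes p: "legal p" and V: "V \<in> verts T" and a: "a \<in> arcs (base \<G>)" "terminus (base \<G>) a = vmap \<pi> V"
    and Z: "Z \<in> adhesion_sets \<G> a"
  shows "\<exists>!A. A \<in> arcs T \<and> terminus T A = V \<and> amap \<pi> A = a \<and> (\<lambda>b. vmap p (terminus S b)) ` A = Z"
proof -
  let ?\<Psi> = "bundle_map \<G> S r \<pi> p"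
  have "\<forall>V\<in>verts T. \<forall>b\<in>arcs (base \<G>). terminus (base \<G>) b = vmap \<pi> V \<longrightarrow>
      (\<forall>Z\<in>adhesion_sets \<G> b.
        \<exists>!A. A \<in> arcs T \<and> terminus T A = V \<and> amap \<pi> A = b \<and> ?\<Psi> A ` Y b = Z)"
    using p unfolding legal_colouring_def Let_def by (elim conjE)
  from this[rule_format, OF V a Z] have ex: "\<exists>!A. A \<in> arcs T \<and> terminus T A = V \<and> amap \<pi> A = a \<and> ?\<Psi> A ` Y a = Z"
    .
  have im: "?\<Psi> A ` Y a = (\<lambda>b. vmap p (terminus S b)) ` A" if "A \<in> arcs T" "amap \<pi> A = a" for A
  proof -
    have "Y a = amap p ` A"
      using legal_bij(2)[OF p that(1)] that(2) by (simp add: bij_betw_def)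
    then show ?thesis
      using bundle_map_apply[OF p that(1)] by (simp add: image_image)
  qed
  have "(A \<in> arcs T \<and> terminus T A = V \<and> amap \<pi> A = a \<and> ?\<Psi> A ` Y a = Z) \<longleftrightarrow>
      (A \<in> arcs T \<and> terminus T A = V \<and> amap \<pi> A = a \<and> (\<lambda>b. vmap p (terminus S b)) ` A = Z)" for A
    using im by blast
  with ex show ?thesis
    by simp
qed

text \<open>Within a bundle the colour of the terminus arises from that of the arc by \<eta>, the
  embedding and \<open>k\<close>, all of them injective, and the colour of the arc determines the
  arc.\<close>

lemma terminus_eq_imp_arc_eq:
  assumes p: "legal p" and A: "A \<in> arcs T" "b \<in> A" "c \<in> A" and t: "terminus S b = terminus S c"
  shows "b = c"
proof -
  let ?a = "amap \<pi> A"
  obtain \<eta> \<zeta> k m where *: "(\<eta>, \<zeta>) \<in> twists \<G> ?a" "k \<in> Grp (terminus (base \<G>) ?a)"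
    and "m \<in> Grp (terminus (base \<G>) (arev (base \<G>) ?a))"
    and **: "\<And>b. b \<in> A \<Longrightarrow> vmap p (terminus S b) = k (emb \<G> ?a (\<eta> (amap p b)))"
    and "\<And>b. b \<in> A \<Longrightarrow> vmap p (origin S b) = m (emb \<G> (arev (base \<G>) ?a) (\<zeta> (amap p b)))"
    using legal_twists[OF p A(1) refl] by blast
  have aT: "?a \<in> arcs (base \<G>)"
    using A(1) \<pi>_arc(1) by (auto simp: arc_T_iff)
  have ap: "bij_betw (amap p) A (Y ?a)"
    using legal_bij(2)[OF p A(1)] .
  have \<eta>: "bij_betw \<eta> (Y ?a) (Y ?a)"
    using Bij_bij_betw[OF twists_Bij(1)[OF gga aT *(1)]] .
  have k: "inj_on k (X (terminus (base \<G>) ?a))"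
    using perms_bij[OF gga_arc(2)[OF gga aT] *(2)] bij_betw_imp_inj_on by blast
  have e: "inj_on (emb \<G> ?a) (Y ?a)" "emb \<G> ?a \<in> Y ?a \<rightarrow> X (terminus (base \<G>) ?a)"
    using gga_arc(4)[OF gga aT] unfolding embedding_def by auto
  have in_Y: "\<eta> (amap p d) \<in> Y ?a" if "d \<in> A" for d
    using that ap \<eta> by (meson bij_betwE)
  have "k (emb \<G> ?a (\<eta> (amap p b))) = k (emb \<G> ?a (\<eta> (amap p c)))"
    using **[OF A(2)] **[OF A(3)] t by simp
  then have "emb \<G> ?a (\<eta> (amap p b)) = emb \<G> ?a (\<eta> (amap p c))"
    using k e(2) in_Y A by (meson inj_onD PiE)
  then have "\<eta> (amap p b) = \<eta> (amap p c)"
    using e(1) in_Y A by (meson inj_onD)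
  then have "amap p b = amap p c"
    using \<eta> ap A by (meson inj_onD bij_betw_imp_inj_on bij_betwE)
  then show ?thesis
    using ap A by (meson inj_onD bij_betw_imp_inj_on)
qed

text \<open>Arcs with common ends lie in the same bundle. This is what allows the arc part of an
  automorphism to be recovered from its vertex part.\<close>

lemma arc_endpoints_inj:
  assumes "legal p" "b \<in> arcs S" "c \<in> arcs S" "origin S b = origin S c" "terminus S b = terminus S c"
  shows "b = c"
  by (rule terminus_eq_imp_arc_eq[OF assms(1), of "abundle b"])
    (use assms in \<open>auto simp: arc_rel_iff arc_T_iff\<close>)

text \<open>The permutation of colours of the arcs that is induced at the terminus lies in the arc group up
  to twists, and so is also induced by a permutation at the origin.\<close>

lemma arc_transfer:
  assumes p: "legal p" and p': "legal p'" and A: "A \<in> arcs T" "amap \<pi> A = a" and B: "B \<in> arcs T" "amap \<pi> B = a"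
    and \<sigma>: "\<sigma> \<in> Grp (terminus (base \<G>) a)"
    and im: "(\<lambda>b. vmap p (terminus S b)) ` B = \<sigma> ` (\<lambda>b. vmap p' (terminus S b)) ` A"
  obtains \<phi> \<rho> where "bij_betw \<phi> A B" "\<rho> \<in> Grp (origin (base \<G>) a)"
    "\<And>b. b \<in> A \<Longrightarrow> vmap p (terminus S (\<phi> b)) = \<sigma> (vmap p' (terminus S b))"
    "\<And>b. b \<in> A \<Longrightarrow> vmap p (origin S (\<phi> b)) = \<rho> (vmap p' (origin S b))"
proof -
  let ?a' = "arev (base \<G>) a" and ?v = "terminus (base \<G>) a"
  let ?\<Phi> = "emb \<G> a" and ?\<Phi>' = "emb \<G> ?a'"
  let ?v' = "terminus (base \<G>) ?a'"
  have aT: "a \<in> arcs (base \<G>)"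
    using A \<pi>_arc(1) by (auto simp: arc_T_iff)
  note ga = gga_arc[OF gga aT]
  have ga': "perm_group_action (vact \<G> ?v')" "embedding ?\<Phi>' (aact \<G> a) (vact \<G> ?v')"
    using gga_arc(2,3,4)[OF gga ga(6)] ga(3) by auto
  obtain \<eta> \<zeta> k m where e: "(\<eta>, \<zeta>) \<in> twists \<G> a" and k: "k \<in> Grp ?v" and m: "m \<in> Grp ?v'"
    and tB: "\<And>b. b \<in> B \<Longrightarrow> vmap p (terminus S b) = k (?\<Phi> (\<eta> (amap p b)))"
    and oB: "\<And>b. b \<in> B \<Longrightarrow> vmap p (origin S b) = m (?\<Phi>' (\<zeta> (amap p b)))"
    using legal_twists[OF p B] by blast
  obtain \<eta>' \<zeta>' k' m' where e': "(\<eta>', \<zeta>') \<in> twists \<G> a" and k': "k' \<in> Grp ?v" and m': "m' \<in> Grp ?v'"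
    and tA: "\<And>b. b \<in> A \<Longrightarrow> vmap p' (terminus S b) = k' (?\<Phi> (\<eta>' (amap p' b)))"
    and oA: "\<And>b. b \<in> A \<Longrightarrow> vmap p' (origin S b) = m' (?\<Phi>' (\<zeta>' (amap p' b)))"
    using legal_twists[OF p' A] by blast
  have apB: "bij_betw (amap p) B (Y a)" and apA: "bij_betw (amap p') A (Y a)"
    using legal_bij(2)[OF p B(1)] legal_bij(2)[OF p' A(1)] A B by auto
  note e_bij = twists_Bij[OF gga aT e, THEN Bij_bij_betw]
    and e'_bij = twists_Bij[OF gga aT e', THEN Bij_bij_betw]
  have \<Phi>: "?\<Phi> y \<in> X ?v" "?\<Phi>' y \<in> X ?v'" if "y \<in> Y a" for y
    using ga(4) ga'(2) that unfolding embedding_def by auto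
  obtain l where l: "l \<in> Grp ?v" "\<And>x. x \<in> X ?v \<Longrightarrow> l (k x) = x" "\<And>x. x \<in> X ?v \<Longrightarrow> k (l x) = x"
    using perms_inverse[OF ga(2) k] by blast
  \<comment> \<open>This is \<sigma> in the coordinates that \<open>k'\<close> and \<open>k\<close>
    give on the termini of \<open>A\<close> and \<open>B\<close>. The twists drop out of the images,
    so \<open>im\<close> makes it stabilise the image of the embedding, and it comes from an element
    \<theta> of the arc group.\<close>
  define \<kappa> where "\<kappa> = compose (X ?v) l (compose (X ?v) \<sigma> k')"
  have \<kappa>: "\<kappa> \<in> Grp ?v"
    unfolding \<kappa>_def by (intro perms_compose ga(2) l(1) \<sigma> k')
  have \<kappa>_apply: "\<kappa> (?\<Phi> y) = l (\<sigma> (k' (?\<Phi> y)))" if "y \<in> Y a" for y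
    using \<Phi>(1)[OF that] by (simp add: \<kappa>_def compose_eq)
  have "\<eta> ` amap p ` B = Y a" "\<eta>' ` amap p' ` A = Y a"
    using e_bij(1) e'_bij(1) apA apB by (auto simp: bij_betw_def)
  moreover have "k ` ?\<Phi> ` \<eta> ` amap p ` B = (\<lambda>b. vmap p (terminus S b)) ` B"
    "k' ` ?\<Phi> ` \<eta>' ` amap p' ` A = (\<lambda>b. vmap p' (terminus S b)) ` A"
    using tA tB by (simp_all add: image_image)
  ultimately have "\<sigma> ` k' ` ?\<Phi> ` Y a = k ` ?\<Phi> ` Y a"
    using im by simp
  then have "l ` \<sigma> ` k' ` ?\<Phi> ` Y a = l ` k ` ?\<Phi> ` Y a"
    by simp
  moreover have "l ` k ` ?\<Phi> ` Y a = ?\<Phi> ` Y a"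
    using l(2) \<Phi>(1) by (force simp: image_image)
  moreover have "l ` \<sigma> ` k' ` ?\<Phi> ` Y a = \<kappa> ` ?\<Phi> ` Y a"
    using \<kappa>_apply by (simp add: image_image)
  ultimately have "\<kappa> ` ?\<Phi> ` Y a = ?\<Phi> ` Y a"
    by simp
  then obtain \<theta> where \<theta>: "\<theta> \<in> perms (aact \<G> a)" "\<And>y. y \<in> Y a \<Longrightarrow> \<kappa> (?\<Phi> y) = ?\<Phi> (\<theta> y)"
    using embedding_perms_restrict[OF ga(4) \<kappa>] by blast
  have \<theta>k: "k (?\<Phi> (\<theta> y)) = \<sigma> (k' (?\<Phi> y))" if "y \<in> Y a" for y
  proof -
    have "\<sigma> (k' (?\<Phi> y)) \<in> X ?v"
      by (intro perms_closed[OF ga(2) \<sigma>] perms_closed[OF ga(2) k'] \<Phi>(1) that)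
    then show ?thesis
      using \<theta>(2)[OF that] \<kappa>_apply[OF that] l(3) by metis
  qed
  \<comment> \<open>\<tau> is the change of arc colours that realises \<theta> at the terminus, and
    \<theta>' is its effect at the origin after the twists there are removed.\<close>
  obtain \<tau> \<theta>' where \<tau>: "\<tau> \<in> Bij (Y a)" and \<theta>': "\<theta>' \<in> perms (aact \<G> a)"
    and tw: "\<And>y. y \<in> Y a \<Longrightarrow> \<eta> (\<tau> y) = \<theta> (\<eta>' y)" "\<And>y. y \<in> Y a \<Longrightarrow> \<zeta> (\<tau> y) = \<theta>' (\<zeta>' y)"
    using twist_transfer[OF gga aT e e' \<theta>(1)] by blast
  obtain n where n: "n \<in> Grp ?v'" "\<And>y. y \<in> Y a \<Longrightarrow> n (?\<Phi>' y) = ?\<Phi>' (\<theta>' y)"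
    using embedding_perms_lift[OF ga'(2) \<theta>'] by blast
  obtain l' where l': "l' \<in> Grp ?v'" "\<And>x. x \<in> X ?v' \<Longrightarrow> l' (m' x) = x"
    using perms_inverse[OF ga'(1) m'] by blast
  \<comment> \<open>\<open>n\<close> extends \<theta>' to the vertex group at the origin;
    \<open>l'\<close> and \<open>m\<close> translate from the coordinates of \<open>A\<close> to
    those of \<open>B\<close>.\<close>
  define \<rho> where "\<rho> = compose (X ?v') m (compose (X ?v') n l')"
  define \<phi> where "\<phi> = inv_into B (amap p) \<circ> (\<tau> \<circ> amap p')"
  have \<phi>: "bij_betw \<phi> A B"
    unfolding \<phi>_def
    by (rule bij_betw_trans[OF bij_betw_trans[OF apA Bij_bij_betw[OF \<tau>]] bij_betw_inv_into[OF apB]])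
  have \<phi>B: "\<phi> b \<in> B" and p\<phi>: "amap p (\<phi> b) = \<tau> (amap p' b)" and Yb: "amap p' b \<in> Y a" if "b \<in> A" for b
  proof -
    show "\<phi> b \<in> B" using \<phi> that bij_betwE by blast
    show y: "amap p' b \<in> Y a" using apA that bij_betwE by blast
    then have "\<tau> (amap p' b) \<in> Y a" using Bij_imp_funcset[OF \<tau>] by blast
    then show "amap p (\<phi> b) = \<tau> (amap p' b)"
      using apB by (simp add: \<phi>_def bij_betw_def f_inv_into_f)
  qed
  show thesis
  proof
    show "bij_betw \<phi> A B" by (rule \<phi>)
    have "\<rho> \<in> Grp ?v'"
      unfolding \<rho>_def by (intro perms_compose ga'(1) m n(1) l'(1))
    then show "\<rho> \<in> Grp (origin (base \<G>) a)"
      using ga(7) by simp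
    fix b assume b: "b \<in> A"
    have \<eta>Y: "\<eta>' (amap p' b) \<in> Y a" "\<zeta>' (amap p' b) \<in> Y a"
      using Yb[OF b] e'_bij bij_betwE by blast+
    show "vmap p (terminus S (\<phi> b)) = \<sigma> (vmap p' (terminus S b))"
      using tB[OF \<phi>B[OF b]] tA[OF b] p\<phi>[OF b] tw(1)[OF Yb[OF b]] \<theta>k[OF \<eta>Y(1)] by simp
    have "\<rho> (vmap p' (origin S b)) = \<rho> (m' (?\<Phi>' (\<zeta>' (amap p' b))))"
      using oA[OF b] by simp
    also have "\<dots> = m (n (?\<Phi>' (\<zeta>' (amap p' b))))"
      using perms_closed[OF ga'(1) m' \<Phi>(2)[OF \<eta>Y(2)]] l'(2)[OF \<Phi>(2)[OF \<eta>Y(2)]]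
      by (simp add: \<rho>_def compose_eq)
    also have "\<dots> = vmap p (origin S (\<phi> b))"
      using oB[OF \<phi>B[OF b]] p\<phi>[OF b] tw(2)[OF Yb[OF b]] n(2)[OF \<eta>Y(2)] by simp
    finally show "vmap p (origin S (\<phi> b)) = \<rho> (vmap p' (origin S b))" ..
  qed
qed

end

section \<open>Matching two legal colourings\<close>

context scaffold
begin

text \<open>Arcs enter only through their ends and their image in the base graph, so that conditions
  on arcs can be imposed on maps of vertices.\<close>

definition arc_over :: "'a \<Rightarrow> 'sv \<Rightarrow> 'sv \<Rightarrow> bool" where
  "arc_over a x y \<longleftrightarrow> (\<exists>b\<in>arcs S. origin S b = x \<and> terminus S b = y \<and> amap \<pi> (abundle b) = a)"

lemma arc_overI: "b \<in> arcs S \<Longrightarrow> arc_over (amap \<pi> (abundle b)) (origin S b) (terminus S b)"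
  unfolding arc_over_def by blast

lemma arc_over_arev: "arc_over a x y \<Longrightarrow> arc_over (arev (base \<G>) a) y x"
  unfolding arc_over_def using S_arc \<pi>_arc(4) by metis

lemma arc_over_adj:
  assumes "arc_over a x y"
  shows "a \<in> arcs (base \<G>)" "x \<in> verts S" "y \<in> verts S" "(vbundle x, vbundle y) \<in> adj T"
  using assms S_arc \<pi>_arc(1) unfolding arc_over_def adj_T_iff by blast+

lemma graph_T: "graph T" and T_endpoints_inj: "A \<in> arcs T \<Longrightarrow> B \<in> arcs T \<Longrightarrow>
    origin T A = origin T B \<Longrightarrow> terminus T A = terminus T B \<Longrightarrow> A = B"
  using tree_T unfolding tree_def by blast+

text \<open>The converse direction excludes arcs between image vertices that do not come from
  \<open>V\<close> and \<open>W\<close>. It later gives equality of terminus sets and surjectivity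
  on arcs.\<close>

definition compatible :: "'sv set \<Rightarrow> 'sv set \<Rightarrow> ('sv \<Rightarrow> 'sv) \<Rightarrow> ('sv \<Rightarrow> 'sv) \<Rightarrow> bool" where
  "compatible V W f u \<longleftrightarrow>
     (\<forall>x\<in>V. \<forall>y\<in>W. \<forall>a\<in>arcs (base \<G>). arc_over a x y \<longleftrightarrow> arc_over a (f x) (u y))"

lemma compatible_sym:
  assumes "compatible V W f u"
  shows "compatible W V u f"
  unfolding compatible_def
proof (intro ballI)
  fix y x a assume *: "y \<in> W" "x \<in> V" "a \<in> arcs (base \<G>)"
  let ?a = "arev (base \<G>) a"
  have a: "?a \<in> arcs (base \<G>)" "arev (base \<G>) ?a = a"
    using gga *(3) unfolding graph_of_group_actions_def graph_def by blast+
  have "arc_over a z w \<longleftrightarrow> arc_over ?a w z" for z w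
    using arc_over_arev[of a z w] arc_over_arev[of ?a w z] a(2) by auto
  then show "arc_over a y x \<longleftrightarrow> arc_over a (u y) (f x)"
    using assms * a unfolding compatible_def by simp
qed

end

locale two_colourings = scaffold \<G> S r \<pi>
  for \<G> :: "('v, 'a, 'g, 'x, 'h, 'y) gga" and S :: "('sv, 'sa) rgraph" and r and \<pi> +
  fixes p p' :: "('sv \<Rightarrow> 'x) \<times> ('sa \<Rightarrow> 'y)"
  assumes p: "legal_colouring \<G> S r \<pi> p" and p': "legal_colouring \<G> S r \<pi> p'"
begin

section \<open>Matches of single bundles and their extension across an arc\<close>

definition local_match :: "'sv set \<Rightarrow> ('sv \<Rightarrow> 'sv) \<Rightarrow> bool" where
  "local_match V f \<longleftrightarrow> f ` V \<in> verts T \<and> vmap \<pi> (f ` V) = vmap \<pi> V \<and>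
     (\<exists>\<sigma>\<in>Grp (vmap \<pi> V). \<forall>x\<in>V. vmap p (f x) = \<sigma> (vmap p' x))"

lemma local_match_inj:
  assumes V: "V \<in> verts T" and f: "local_match V f"
  shows "inj_on f V"
proof (rule inj_onI)
  fix x y assume xy: "x \<in> V" "y \<in> V" "f x = f y"
  obtain \<sigma> where \<sigma>: "\<sigma> \<in> Grp (vmap \<pi> V)" "\<And>x. x \<in> V \<Longrightarrow> vmap p (f x) = \<sigma> (vmap p' x)"
    using f unfolding local_match_def by blast
  have "\<sigma> (vmap p' x) = \<sigma> (vmap p' y)"
    using \<sigma>(2) xy by metis
  then have "vmap p' x = vmap p' y"
    using perms_bij[OF vact_\<pi>[OF V] \<sigma>(1)] legal_bij(1)[OF p' V] xy
    by (meson bij_betw_imp_inj_on bij_betwE inj_onD)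
  then show "x = y"
    using legal_bij(1)[OF p' V] xy by (meson bij_betw_imp_inj_on inj_onD)
qed

text \<open>A local match is the conjugate of a colour permutation by the two colourings.\<close>

lemma local_match_colour:
  assumes V: "V \<in> verts T" "V' \<in> verts T" "vmap \<pi> V' = vmap \<pi> V" and \<sigma>: "\<sigma> \<in> Grp (vmap \<pi> V)"
  shows "\<exists>f. local_match V f \<and> f ` V = V' \<and> (\<forall>x\<in>V. vmap p (f x) = \<sigma> (vmap p' x))"
proof -
  let ?f = "\<lambda>x. inv_into V' (vmap p) (\<sigma> (vmap p' x))"
  have bij: "bij_betw (vmap p') V (X (vmap \<pi> V))" "bij_betw \<sigma> (X (vmap \<pi> V)) (X (vmap \<pi> V))"
    "bij_betw (vmap p) V' (X (vmap \<pi> V))"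
    using legal_bij(1)[OF p' V(1)] legal_bij(1)[OF p V(2)] perms_bij[OF vact_\<pi>[OF V(1)] \<sigma>] V(3)
    by simp_all
  have "bij_betw (inv_into V' (vmap p) \<circ> (\<sigma> \<circ> vmap p')) V V'"
    by (rule bij_betw_trans[OF bij_betw_trans[OF bij(1,2)] bij_betw_inv_into[OF bij(3)]])
  then have im: "?f ` V = V'"
    by (simp add: bij_betw_def comp_def)
  have c: "vmap p (?f x) = \<sigma> (vmap p' x)" if "x \<in> V" for x
  proof -
    have "\<sigma> (vmap p' x) \<in> X (vmap \<pi> V)"
      using that bij(1,2) by (meson bij_betwE)
    then show ?thesis
      using bij(3) by (simp add: bij_betw_def f_inv_into_f)
  qed
  have "local_match V ?f"
    unfolding local_match_def im using V \<sigma> c by blast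
  with im c show ?thesis
    by (intro exI[of _ ?f]) simp
qed

text \<open>The bundle \<open>A\<close> is oriented towards \<open>V\<close>, since legality
  prescribes adhesion sets at termini. On \<open>W\<close> the permutation \<rho> matters only at
  the colours of origins of arcs in \<open>A\<close>; any element of the vertex group agreeing with
  it there would do.\<close>

lemma local_match_extend:
  assumes VW: "(V, W) \<in> adj T" and f: "local_match V f"
  shows "\<exists>u. local_match W u \<and> compatible V W f u"
proof -
  have "(W, V) \<in> adj T"
    using graph_adj[OF graph_T] VW by blast
  then obtain b0 where b0: "b0 \<in> arcs S" "W = vbundle (origin S b0)" "V = vbundle (terminus S b0)"
    unfolding adj_T_iff by blast
  define A a where "A = abundle b0" and "a = amap \<pi> A"
  have A: "A \<in> arcs T" "terminus T A = V" "origin T A = W"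
    using b0 T_arc by (auto simp: A_def arc_T_iff)
  have a: "a \<in> arcs (base \<G>)" "terminus (base \<G>) a = vmap \<pi> V" "origin (base \<G>) a = vmap \<pi> W"
    using \<pi>_arc[OF b0(1)] b0 by (simp_all add: a_def A_def)
  have A_iff: "b \<in> A \<longleftrightarrow> b \<in> arcs S \<and> vbundle (origin S b) = W \<and> vbundle (terminus S b) = V" for b
    using b0 by (auto simp: A_def abundle_eq)
  have V: "V \<in> verts T" and W: "W \<in> verts T"
    using graph_adj[OF graph_T VW] by auto
  obtain \<sigma> where V': "f ` V \<in> verts T" "vmap \<pi> (f ` V) = vmap \<pi> V" and \<sigma>: "\<sigma> \<in> Grp (vmap \<pi> V)"
    "\<And>x. x \<in> V \<Longrightarrow> vmap p (f x) = \<sigma> (vmap p' x)"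
    using f unfolding local_match_def by blast
  have \<sigma>a: "\<sigma> \<in> Grp (terminus (base \<G>) a)"
    using \<sigma>(1) a(2) by simp
  have "\<sigma> ` (\<lambda>b. vmap p' (terminus S b)) ` A \<in> adhesion_sets \<G> a"
    using adhesion_sets_image[OF a(1) \<sigma>a] legal_terminus_image[OF p' A(1)] a_def by blast
  then obtain B where B: "B \<in> arcs T" "terminus T B = f ` V" "amap \<pi> B = a"
    "(\<lambda>b. vmap p (terminus S b)) ` B = \<sigma> ` (\<lambda>b. vmap p' (terminus S b)) ` A"
    using legal_adhesion_arc[OF p V'(1) a(1)] a(2) V'(2) by metis
  obtain \<phi> \<rho> where \<phi>: "bij_betw \<phi> A B" and \<rho>: "\<rho> \<in> Grp (origin (base \<G>) a)"
    and t\<phi>: "\<And>b. b \<in> A \<Longrightarrow> vmap p (terminus S (\<phi> b)) = \<sigma> (vmap p' (terminus S b))"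
    and o\<phi>: "\<And>b. b \<in> A \<Longrightarrow> vmap p (origin S (\<phi> b)) = \<rho> (vmap p' (origin S b))"
    using arc_transfer[OF p p' A(1) a_def[symmetric] B(1,3) \<sigma>a B(4)] by blast
  obtain c0 where c0: "c0 \<in> arcs S" "B = abundle c0"
    using B(1) by (auto simp: arc_T_iff)
  define W' where "W' = vbundle (origin S c0)"
  have W': "W' \<in> verts T" "vmap \<pi> W' = vmap \<pi> W"
    using c0 S_arc \<pi>_arc(2) B(3) a(3) by (auto simp: W'_def vert_T_iff)
  have fV: "f ` V = vbundle (terminus S c0)"
    using B(2) T_arc(2) c0 by simp
  have B_iff: "b \<in> B \<longleftrightarrow> b \<in> arcs S \<and> vbundle (origin S b) = W' \<and> vbundle (terminus S b) = f ` V" for b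
    using c0 fV by (auto simp: W'_def abundle_eq)
  have \<rho>': "\<rho> \<in> Grp (vmap \<pi> W)"
    using \<rho> a(3) by simp
  obtain u where u: "local_match W u" "u ` W = W'" "\<And>y. y \<in> W \<Longrightarrow> vmap p (u y) = \<rho> (vmap p' y)"
    using local_match_colour[OF W W' \<rho>'] by blast
  have mem: "x \<in> vbundle x" if "x \<in> verts S" for x
    using r_refl that by blast
  have in_A: "origin S b \<in> W" "terminus S b \<in> V" if "b \<in> A" for b
    using that mem S_arc unfolding A_iff by blast+
  have in_B: "origin S b \<in> W'" "terminus S b \<in> f ` V" if "b \<in> B" for b
    using that mem S_arc unfolding B_iff by blast+
  have \<phi>B: "\<phi> b \<in> B" if "b \<in> A" for b
    using \<phi> that bij_betwE by blast
  \<comment> \<open>Both sides lie in one bundle and have the same colour under \<open>p\<close>,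
    which is injective there.\<close>
  have \<phi>_ends: "origin S (\<phi> b) = u (origin S b)" "terminus S (\<phi> b) = f (terminus S b)" if "b \<in> A" for b
  proof -
    have "vmap p (origin S (\<phi> b)) = vmap p (u (origin S b))"
      using o\<phi> u(3) in_A that by simp
    then show "origin S (\<phi> b) = u (origin S b)"
      using legal_bij(1)[OF p W'(1)] in_B(1)[OF \<phi>B[OF that]] in_A(1)[OF that] u(2)
      by (meson bij_betw_imp_inj_on inj_onD imageI)
    have "vmap p (terminus S (\<phi> b)) = vmap p (f (terminus S b))"
      using t\<phi> \<sigma>(2) in_A that by simp
    then show "terminus S (\<phi> b) = f (terminus S b)"
      using legal_bij(1)[OF p V'(1)] in_B(2)[OF \<phi>B[OF that]] in_A(2)[OF that]
      by (meson bij_betw_imp_inj_on inj_onD imageI)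
  qed
  \<comment> \<open>Forwards an arc is moved by \<phi>. Backwards an arc between images lies in
    \<open>B\<close>, hence is some \<open>\<phi> b\<close>, and injectivity of \<open>u\<close> and
    \<open>f\<close> identifies the ends of \<open>b\<close>.\<close>
  have "arc_over d y x \<longleftrightarrow> arc_over d (u y) (f x)" if y: "y \<in> W" and x: "x \<in> V" for d x y
  proof
    assume "arc_over d y x"
    then obtain b where b: "b \<in> arcs S" "origin S b = y" "terminus S b = x" "amap \<pi> (abundle b) = d"
      unfolding arc_over_def by blast
    have bA: "b \<in> A"
      unfolding A_iff using b x y vert_T_bundle V W by blast
    then have "d = a"
      using b(4) arc_T_bundle[OF A(1)] a_def by blast
    moreover have "\<phi> b \<in> arcs S" "abundle (\<phi> b) = B"
      using arc_T_bundle[OF B(1) \<phi>B[OF bA]] by auto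
    ultimately show "arc_over d (u y) (f x)"
      using arc_overI[of "\<phi> b"] \<phi>_ends[OF bA] B(3) b by simp
  next
    assume "arc_over d (u y) (f x)"
    then obtain c where c: "c \<in> arcs S" "origin S c = u y" "terminus S c = f x" "amap \<pi> (abundle c) = d"
      unfolding arc_over_def by blast
    have "u y \<in> W'" "f x \<in> f ` V"
      using u(2) x y by auto
    then have cB: "c \<in> B"
      unfolding B_iff using c vert_T_bundle V'(1) W'(1) by metis
    then have "d = a"
      using c(4) arc_T_bundle[OF B(1)] B(3) by blast
    obtain b where b: "b \<in> A" "c = \<phi> b"
      using cB \<phi> by (auto simp: bij_betw_def)
    have "origin S b = y" "terminus S b = x"
      using \<phi>_ends[OF b(1)] c b(2) in_A[OF b(1)] x y local_match_inj[OF V f] local_match_inj[OF W u(1)]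
      by (auto dest: inj_onD)
    then show "arc_over d y x"
      using arc_overI[of b] arc_T_bundle[OF A(1) b(1)] a_def \<open>d = a\<close> by auto
  qed
  then have "compatible W V u f"
    unfolding compatible_def by blast
  then show ?thesis
    using u(1) compatible_sym by blast
qed

text \<open>Only adjacent bundles are constrained, as this is what the recursion along the tree
  delivers. For arbitrary vertices one must know that bundles with adjacent images are adjacent,
  which needs bijectivity on bundles.\<close>

definition matching :: "('sv \<Rightarrow> 'sv) \<Rightarrow> bool" where
  "matching g \<longleftrightarrow> (\<forall>V\<in>verts T. local_match V g) \<and>
     (\<forall>x\<in>verts S. \<forall>y\<in>verts S. (vbundle x, vbundle y) \<in> adj T \<longrightarrow>
        (\<forall>a. arc_over a x y \<longleftrightarrow> arc_over a (g x) (g y)))"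

lemma matching_exists: "\<exists>g. matching g"
proof (cases "verts T = {}")
  case True
  then have "verts S = {}"
    using vert_T_iff by blast
  then show ?thesis
    using True by (simp add: matching_def)
next
  case False
  then obtain V0 where V0: "V0 \<in> verts T" by blast
  \<comment> \<open>The root is matched with itself through the identity of the colours; any bundle
    with the same image under \<pi> and any element of the vertex group could start the
    recursion.\<close>
  obtain f0 where "local_match V0 f0"
    using local_match_colour[OF V0 V0 refl perms_one[OF vact_\<pi>[OF V0]]] by blast
  then have "\<exists>s. s V0 = f0 \<and> (\<forall>V\<in>verts T. local_match V (s V)) \<and>
      (\<forall>(V, W)\<in>adj T. compatible V W (s V) (s W))"
  proof (rule tree_section[where P = local_match and Q = compatible, OF tree_T V0])
    show "\<exists>u. local_match W u \<and> compatible V W f u" if "(V, W) \<in> adj T" "local_match V f" for V W f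
      using local_match_extend[OF that] .
    show "compatible W V u f" if "compatible V W f u" for V W f u
      using compatible_sym[OF that] .
  qed
  then obtain s where s: "\<And>V. V \<in> verts T \<Longrightarrow> local_match V (s V)"
    "\<And>V W. (V, W) \<in> adj T \<Longrightarrow> compatible V W (s V) (s W)" by blast
  \<comment> \<open>Of each chosen map only the values on its own bundle are kept.\<close>
  define g where "g x = s (vbundle x) x" for x
  have g: "g x = s V x" if "V \<in> verts T" "x \<in> V" for V x
    using vert_T_bundle[OF that] by (simp add: g_def)
  have "local_match V g" if V: "V \<in> verts T" for V
  proof -
    have "g ` V = s V ` V"
      using g[OF V] by simp
    then show ?thesis
      using s(1)[OF V] g[OF V] unfolding local_match_def by simp
  qed
  moreover have "arc_over a x y \<longleftrightarrow> arc_over a (g x) (g y)"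
    if xy: "x \<in> verts S" "y \<in> verts S" and adj: "(vbundle x, vbundle y) \<in> adj T" for a x y
  proof -
    have "x \<in> vbundle x" "y \<in> vbundle y"
      using xy r_refl by auto
    then have "a \<in> arcs (base \<G>) \<Longrightarrow> arc_over a x y \<longleftrightarrow> arc_over a (g x) (g y)"
      using s(2)[OF adj] unfolding compatible_def g_def by blast
    then show ?thesis
      using arc_over_adj(1) by blast
  qed
  ultimately show ?thesis
    unfolding matching_def by blast
qed

section \<open>Invertibility of a matching\<close>

context
  fixes g
  assumes g: "matching g"
begin

lemma matching_local: "V \<in> verts T \<Longrightarrow> local_match V g"
  using g unfolding matching_def by blast

lemma matching_arc_over:
  "x \<in> verts S \<Longrightarrow> y \<in> verts S \<Longrightarrow> (vbundle x, vbundle y) \<in> adj T \<Longrightarrow>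
    arc_over a x y \<longleftrightarrow> arc_over a (g x) (g y)"
  using g unfolding matching_def by blast

lemma matching_vert: "V \<in> verts T \<Longrightarrow> g ` V \<in> verts T" "V \<in> verts T \<Longrightarrow> vmap \<pi> (g ` V) = vmap \<pi> V"
  using matching_local unfolding local_match_def by blast+

lemma matching_vbundle:
  assumes "x \<in> verts S"
  shows "g x \<in> verts S" "vbundle (g x) = g ` vbundle x"
proof -
  have "vbundle x \<in> verts T" "g x \<in> g ` vbundle x"
    using assms r_refl by (auto simp: vert_T_iff)
  then show "g x \<in> verts S" "vbundle (g x) = g ` vbundle x"
    using matching_vert(1) vert_T_bundle by blast+
qed

lemma matching_arc:
  assumes "b \<in> arcs S"
  obtains c where "c \<in> arcs S" "origin S c = g (origin S b)" "terminus S c = g (terminus S b)"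
    "amap \<pi> (abundle c) = amap \<pi> (abundle b)"
proof -
  have "(vbundle (origin S b), vbundle (terminus S b)) \<in> adj T"
    using assms adj_T_iff by blast
  then have "arc_over (amap \<pi> (abundle b)) (g (origin S b)) (g (terminus S b))"
    using matching_arc_over[OF S_arc(1)[OF assms] S_arc(2)[OF assms]] arc_overI[OF assms] by blast
  then show thesis
    using that unfolding arc_over_def by blast
qed

lemma matching_adj:
  assumes "(V, W) \<in> adj T"
  shows "(g ` V, g ` W) \<in> adj T"
proof -
  obtain b where b: "b \<in> arcs S" "V = vbundle (origin S b)" "W = vbundle (terminus S b)"
    using assms adj_T_iff by blast
  obtain c where "c \<in> arcs S" "origin S c = g (origin S b)" "terminus S c = g (terminus S b)"
    using matching_arc[OF b(1)] by blast
  then show ?thesis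
    using b S_arc matching_vbundle(2) adj_T_iff by metis
qed

text \<open>Equality of the terminus sets, not just inclusion, is the point: it turns images of
  bundles into equations between adhesion sets, to which uniqueness applies. The two inclusions are
  the two directions of the equivalence on arcs.\<close>

lemma matching_arc_bundle:
  assumes A: "A \<in> arcs T"
  obtains B where "B \<in> arcs T" "origin T B = g ` origin T A" "terminus T B = g ` terminus T A"
    "amap \<pi> B = amap \<pi> A" "terminus S ` B = g ` terminus S ` A"
proof -
  obtain b0 where b0: "b0 \<in> arcs S" "A = abundle b0"
    using A by (auto simp: arc_T_iff)
  note ends = S_arc(1,2)[OF b0(1)]
  obtain c0 where c0: "c0 \<in> arcs S" "origin S c0 = g (origin S b0)" "terminus S c0 = g (terminus S b0)"
    "amap \<pi> (abundle c0) = amap \<pi> (abundle b0)"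
    by (rule matching_arc[OF b0(1)])
  have obj: "vbundle (origin S c0) = g ` vbundle (origin S b0)"
    "vbundle (terminus S c0) = g ` vbundle (terminus S b0)"
    using c0 ends matching_vbundle(2) by simp_all
  have adj0: "(vbundle (origin S b0), vbundle (terminus S b0)) \<in> adj T"
    using b0(1) adj_T_iff by blast
  have mem: "x \<in> vbundle x" if "x \<in> verts S" for x
    using r_refl that by blast
  show thesis
  proof
    show "abundle c0 \<in> arcs T" using c0(1) by (auto simp: arc_T_iff)
    show "origin T (abundle c0) = g ` origin T A" "terminus T (abundle c0) = g ` terminus T A"
      "amap \<pi> (abundle c0) = amap \<pi> A"
      using T_arc(1,2) obj b0 c0 by simp_all
    show "terminus S ` abundle c0 = g ` terminus S ` A"
    proof
      show "g ` terminus S ` A \<subseteq> terminus S ` abundle c0"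
      proof (rule image_subsetI, elim imageE)
        fix x b assume b: "x = terminus S b" "b \<in> A"
        then have bS: "b \<in> arcs S" "vbundle (origin S b) = vbundle (origin S b0)"
          "vbundle (terminus S b) = vbundle (terminus S b0)"
          using b0 by (auto simp: abundle_eq)
        obtain c where c: "c \<in> arcs S" "origin S c = g (origin S b)" "terminus S c = g (terminus S b)"
          using matching_arc[OF bS(1)] by blast
        then have "c \<in> abundle c0"
          using bS obj S_arc(1,2)[OF bS(1)] matching_vbundle(2) c0(1) by (simp add: abundle_eq)
        then show "g x \<in> terminus S ` abundle c0"
          using b(1) c(3) by (metis imageI)
      qed
      show "terminus S ` abundle c0 \<subseteq> g ` terminus S ` A"
      proof (rule image_subsetI)
        fix c assume "c \<in> abundle c0"
        then have c: "c \<in> arcs S" "vbundle (origin S c) = g ` vbundle (origin S b0)"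
          "vbundle (terminus S c) = g ` vbundle (terminus S b0)"
          using obj c0(1) by (simp_all add: abundle_eq)
        then have "origin S c \<in> g ` vbundle (origin S b0)" "terminus S c \<in> g ` vbundle (terminus S b0)"
          using mem S_arc by blast+
        then obtain x y where xy: "x \<in> vbundle (origin S b0)" "y \<in> vbundle (terminus S b0)"
          "origin S c = g x" "terminus S c = g y" by auto
        have x: "x \<in> verts S" "vbundle x = vbundle (origin S b0)"
          and y: "y \<in> verts S" "vbundle y = vbundle (terminus S b0)"
          using xy(1,2) vert_T_bundle ends vert_T_iff by metis+
        have "arc_over (amap \<pi> (abundle c)) x y"
          using matching_arc_over[OF x(1) y(1)] arc_overI[OF c(1)] xy x y adj0 by simp
        then obtain b where b: "b \<in> arcs S" "origin S b = x" "terminus S b = y"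
          unfolding arc_over_def by blast
        then have "b \<in> A"
          using b0 x y by (simp add: abundle_eq)
        then show "terminus S c \<in> g ` terminus S ` A"
          using b(3) xy(4) by blast
      qed
    qed
  qed
qed

lemma adj_T_arc:
  assumes "(V, W) \<in> adj T"
  obtains A where "A \<in> arcs T" "origin T A = W" "terminus T A = V"
  using graph_adj(1)[OF graph_T assms] unfolding adj_def by blast

lemma terminus_bundle: "A \<in> arcs T \<Longrightarrow> terminus S ` A \<subseteq> terminus T A"
  using arc_T_bundle T_arc(2) S_arc(2) r_refl by fastforce

text \<open>The inverse of \<sigma> pulls the adhesion set of \<open>B\<close> back to one at
  \<open>V\<close>, which legality of \<open>p'\<close> assigns to an arc \<open>A\<close>. The
  image of \<open>A\<close> has the terminus, the base arc and the adhesion set of \<open>B\<close>,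
  so uniqueness for \<open>p\<close> gives equality.\<close>

lemma matching_adj_surj:
  assumes V: "V \<in> verts T" and adj: "(g ` V, W') \<in> adj T"
  shows "\<exists>W. (V, W) \<in> adj T \<and> g ` W = W'"
proof -
  obtain B where B: "B \<in> arcs T" "origin T B = W'" "terminus T B = g ` V"
    using adj by (rule adj_T_arc)
  obtain \<sigma> where \<sigma>: "\<sigma> \<in> Grp (vmap \<pi> V)" "\<And>x. x \<in> V \<Longrightarrow> vmap p (g x) = \<sigma> (vmap p' x)"
    using matching_local[OF V] unfolding local_match_def by blast
  obtain l where l: "l \<in> Grp (vmap \<pi> V)" "\<And>x. x \<in> X (vmap \<pi> V) \<Longrightarrow> \<sigma> (l x) = x"
    using perms_inverse[OF vact_\<pi>[OF V] \<sigma>(1)] by blast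
  obtain b where "b \<in> arcs S" "B = abundle b"
    using B(1) arc_T_iff by blast
  then have a: "amap \<pi> B \<in> arcs (base \<G>)" "terminus (base \<G>) (amap \<pi> B) = vmap \<pi> (g ` V)"
    using \<pi>_arc T_arc(2) B(3) by auto
  note aV = a(2)[unfolded matching_vert(2)[OF V]]
  let ?Z = "(\<lambda>b. vmap p (terminus S b)) ` B"
  have Z: "?Z \<in> adhesion_sets \<G> (amap \<pi> B)"
    using legal_terminus_image[OF p B(1) refl] .
  have ZX: "?Z \<subseteq> X (vmap \<pi> V)"
    using terminus_bundle[OF B(1)] B(3) legal_bij(1)[OF p matching_vert(1)[OF V]] matching_vert(2)[OF V]
    by (auto simp: bij_betw_def subset_iff)
  have "l ` ?Z \<in> adhesion_sets \<G> (amap \<pi> B)"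
    using adhesion_sets_image[OF a(1) _ Z] l(1) aV by simp
  then obtain A where A: "A \<in> arcs T" "terminus T A = V" "amap \<pi> A = amap \<pi> B"
    "(\<lambda>b. vmap p' (terminus S b)) ` A = l ` ?Z"
    using legal_adhesion_arc[OF p' V a(1) aV] by metis
  obtain B' where B': "B' \<in> arcs T" "origin T B' = g ` origin T A" "terminus T B' = g ` V"
    "amap \<pi> B' = amap \<pi> A" "terminus S ` B' = g ` terminus S ` A"
    using matching_arc_bundle[OF A(1)] A(2) by metis
  have "(\<lambda>b. vmap p (terminus S b)) ` B' = vmap p ` g ` terminus S ` A"
    using B'(5) by (metis image_image)
  also have "\<dots> = \<sigma> ` (\<lambda>b. vmap p' (terminus S b)) ` A"
    unfolding image_image using terminus_bundle[OF A(1)] A(2) \<sigma>(2) by (intro image_cong) auto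
  also have "\<dots> = (\<lambda>x. \<sigma> (l x)) ` ?Z"
    unfolding A(4) by (simp add: image_image)
  also have "\<dots> = ?Z"
    using l(2) ZX by force
  finally have "B' = B"
    using legal_adhesion_arc[OF p matching_vert(1)[OF V] a Z] B B' A(3) by metis
  then have "g ` origin T A = W'"
    using B'(2) B(2) by simp
  moreover have "(V, origin T A) \<in> adj T"
    using graph_adj(1)[OF graph_T, of "origin T A" V] A(1,2) unfolding adj_def by blast
  ultimately show "\<exists>W. (V, W) \<in> adj T \<and> g ` W = W'"
    by blast
qed

text \<open>For local injectivity, two arc bundles ending in \<open>V\<close> with the same image
  have the same base arc and, as \<open>g\<close> is injective on \<open>V\<close>, the same
  termini. Uniqueness for \<open>p'\<close> then makes them equal.\<close>

lemma matching_bij_bundles: "bij_betw ((`) g) (verts T) (verts T)"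
proof (rule tree_covering_bij[OF tree_T])
  show "(`) g \<in> verts T \<rightarrow> verts T"
    using matching_vert(1) by blast
  show "(g ` V, g ` W) \<in> adj T" if "(V, W) \<in> adj T" for V W
    using matching_adj[OF that] .
next
  fix V W1 W2 assume VW: "(V, W1) \<in> adj T" "(V, W2) \<in> adj T" and eq: "g ` W1 = g ` W2"
  have V: "V \<in> verts T"
    using graph_adj[OF graph_T VW(1)] by blast
  obtain A1 where A1: "A1 \<in> arcs T" "origin T A1 = W1" "terminus T A1 = V"
    using VW(1) by (rule adj_T_arc)
  obtain A2 where A2: "A2 \<in> arcs T" "origin T A2 = W2" "terminus T A2 = V"
    using VW(2) by (rule adj_T_arc)
  obtain B1 where B1: "B1 \<in> arcs T" "origin T B1 = g ` W1" "terminus T B1 = g ` V"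
    "amap \<pi> B1 = amap \<pi> A1" "terminus S ` B1 = g ` terminus S ` A1"
    using matching_arc_bundle[OF A1(1)] A1 by metis
  obtain B2 where B2: "B2 \<in> arcs T" "origin T B2 = g ` W2" "terminus T B2 = g ` V"
    "amap \<pi> B2 = amap \<pi> A2" "terminus S ` B2 = g ` terminus S ` A2"
    using matching_arc_bundle[OF A2(1)] A2 by metis
  have "B1 = B2"
    using T_endpoints_inj B1 B2 eq by metis
  then have "g ` terminus S ` A1 = g ` terminus S ` A2" and \<pi>: "amap \<pi> A1 = amap \<pi> A2"
    using B1 B2 by auto
  moreover have "terminus S ` A1 \<subseteq> V" "terminus S ` A2 \<subseteq> V"
    using terminus_bundle[OF A1(1)] terminus_bundle[OF A2(1)] A1(3) A2(3) by simp_all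
  ultimately have "terminus S ` A1 = terminus S ` A2"
    using inj_on_image_eq_iff[OF local_match_inj[OF V matching_local[OF V]]] by metis
  then have "vmap p' ` terminus S ` A1 = vmap p' ` terminus S ` A2"
    by simp
  then have im: "(\<lambda>b. vmap p' (terminus S b)) ` A1 = (\<lambda>b. vmap p' (terminus S b)) ` A2"
    by (simp add: image_image)
  obtain b where "b \<in> arcs S" "A1 = abundle b"
    using A1(1) arc_T_iff by blast
  then have "amap \<pi> A1 \<in> arcs (base \<G>)" "terminus (base \<G>) (amap \<pi> A1) = vmap \<pi> V"
    using \<pi>_arc T_arc(2) A1(3) by auto
  then have "A1 = A2"
    using legal_adhesion_arc[OF p' V _ _ legal_terminus_image[OF p' A1(1) refl]] A1 A2 \<pi> im by metis
  then show "W1 = W2"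
    using A1 A2 by simp
qed (use matching_adj_surj in blast)

lemma matching_bij: "bij_betw g (verts S) (verts S)"
proof (rule bij_betw_imageI)
  show "inj_on g (verts S)"
  proof (rule inj_onI)
    fix x y assume xy: "x \<in> verts S" "y \<in> verts S" "g x = g y"
    have V: "vbundle x \<in> verts T" "vbundle y \<in> verts T"
      using xy vert_T_iff by blast+
    have "g ` vbundle x = g ` vbundle y"
      using matching_vbundle(2) xy by metis
    then have "vbundle x = vbundle y"
      using matching_bij_bundles V by (meson bij_betw_imp_inj_on inj_onD)
    then show "x = y"
      using local_match_inj[OF V(1) matching_local[OF V(1)]] xy r_refl by (metis Image_singleton_iff inj_onD)
  qed
  show "g ` verts S = verts S"
  proof
    show "g ` verts S \<subseteq> verts S"
      using matching_vbundle(1) by blast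
    show "verts S \<subseteq> g ` verts S"
    proof
      fix y assume y: "y \<in> verts S"
      then have "vbundle y \<in> (`) g ` verts T"
        using matching_bij_bundles vert_T_iff by (metis bij_betw_imp_surj_on)
      then obtain V where "V \<in> verts T" "vbundle y = g ` V" by blast
      then show "y \<in> g ` verts S"
        using y r_refl vert_T_bundle by (metis Image_singleton_iff image_iff)
    qed
  qed
qed

lemma matching_vbundle_eq_iff:
  assumes "x \<in> verts S" "y \<in> verts S"
  shows "(x, y) \<in> r \<longleftrightarrow> (g x, g y) \<in> r"
proof -
  have "(g x, g y) \<in> r \<longleftrightarrow> g ` vbundle x = g ` vbundle y"
    using vbundle_eq_iff[of "g x" "g y"] matching_vbundle assms by simp
  also have "\<dots> \<longleftrightarrow> vbundle x = vbundle y"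
    using matching_bij_bundles assms vert_T_iff by (metis bij_betw_imp_inj_on inj_on_contraD)
  finally show ?thesis
    using vbundle_eq_iff assms by simp
qed

text \<open>An edge between the images of two bundles lifts to an edge at the first bundle; its
  other end has the same image as the second bundle and therefore equals it.\<close>

lemma matching_arc_over_iff:
  assumes "x \<in> verts S" "y \<in> verts S"
  shows "arc_over a x y \<longleftrightarrow> arc_over a (g x) (g y)"
proof -
  have "(vbundle x, vbundle y) \<in> adj T" if "arc_over a (g x) (g y)"
  proof -
    have V: "vbundle x \<in> verts T" "vbundle y \<in> verts T"
      using assms vert_T_iff by blast+
    have "(g ` vbundle x, g ` vbundle y) \<in> adj T"
      using arc_over_adj(4)[OF that] matching_vbundle(2) assms by simp
    then obtain W where W: "(vbundle x, W) \<in> adj T" "g ` W = g ` vbundle y"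
      using matching_adj_surj[OF V(1)] by blast
    then have "W = vbundle y"
      using matching_bij_bundles V(2) graph_adj(3)[OF graph_T W(1)]
      by (meson bij_betw_imp_inj_on inj_onD)
    then show ?thesis
      using W(1) by simp
  qed
  then show ?thesis
    using matching_arc_over[OF assms] arc_over_adj(4) by blast
qed

end

end

section \<open>Scaffolding automorphisms\<close>

context scaffold
begin

text \<open>A morphism carries ends of arcs to ends of arcs, so preservation of \<open>r\<close>
  passes on to \<open>arc_rel\<close>.\<close>

lemma aut_sc_iff: "u \<in> carrier (aut_sc S r \<pi>) \<longleftrightarrow>
    vmap u \<in> Bij (verts S) \<and> amap u \<in> Bij (arcs S) \<and>
    (\<forall>b\<in>arcs S. origin S (amap u b) = vmap u (origin S b) \<and>
       terminus S (amap u b) = vmap u (terminus S b) \<and> arev S (amap u b) = amap u (arev S b)) \<and>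
    (\<forall>x\<in>verts S. \<forall>y\<in>verts S. (x, y) \<in> r \<longleftrightarrow> (vmap u x, vmap u y) \<in> r) \<and>
    (\<forall>x\<in>verts S. vmap \<pi> (vbundle (vmap u x)) = vmap \<pi> (vbundle x)) \<and>
    (\<forall>b\<in>arcs S. amap \<pi> (abundle (amap u b)) = amap \<pi> (abundle b))"
  (is "_ \<longleftrightarrow> ?V \<and> ?A \<and> ?M \<and> ?r \<and> ?v \<and> ?a")
proof -
  have "(x, y) \<in> arc_rel S r \<longleftrightarrow> (amap u x, amap u y) \<in> arc_rel S r"
    if "?A" "?M" "?r" "x \<in> arcs S" "y \<in> arcs S" for x y
    using that S_arc Bij_imp_funcset[OF that(1)] by (auto simp: arc_rel_def)
  moreover have "graph_morphism S S u \<longleftrightarrow> ?M" if "?V" "?A"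
    using Bij_imp_funcset[OF that(1)] Bij_imp_funcset[OF that(2)] by (simp add: graph_morphism_def)
  ultimately show ?thesis
    unfolding aut_sc_def by (cases u) (auto simp: BijGroup_simps)
qed

section \<open>Group structure of the scaffolding automorphisms\<close>

abbreviation Sym :: "(('sv \<Rightarrow> 'sv) \<times> ('sa \<Rightarrow> 'sa)) monoid" where
  "Sym \<equiv> BijGroup (verts S) \<times>\<times> BijGroup (arcs S)"

lemma group_Sym: "group Sym"
  by (intro DirProd_group group_BijGroup)

lemma Sym_mult:
  assumes "vmap u \<in> Bij (verts S)" "amap u \<in> Bij (arcs S)" "vmap w \<in> Bij (verts S)" "amap w \<in> Bij (arcs S)"
  shows "u \<otimes>\<^bsub>Sym\<^esub> w = (compose (verts S) (vmap u) (vmap w), compose (arcs S) (amap u) (amap w))"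
  using assms by (cases u; cases w) (simp add: BijGroup_simps)

lemma Sym_inv:
  assumes "vmap u \<in> Bij (verts S)" "amap u \<in> Bij (arcs S)"
  shows "inv\<^bsub>Sym\<^esub> u = (restrict (inv_into (verts S) (vmap u)) (verts S),
    restrict (inv_into (arcs S) (amap u)) (arcs S))"
  using assms by (cases u) (simp add: BijGroup_simps group_BijGroup inv_BijGroup)

lemma subgroup_aut_sc: "subgroup (carrier (aut_sc S r \<pi>)) Sym"
proof (rule subgroup.intro)
  show "carrier (aut_sc S r \<pi>) \<subseteq> carrier Sym"
    unfolding aut_sc_def by auto
  show "\<one>\<^bsub>Sym\<^esub> \<in> carrier (aut_sc S r \<pi>)"
    unfolding aut_sc_iff using S_arc by (simp add: BijGroup_simps id_Bij)
next
  fix u w assume u: "u \<in> carrier (aut_sc S r \<pi>)" and w: "w \<in> carrier (aut_sc S r \<pi>)"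
  note u' = u[unfolded aut_sc_iff] and w' = w[unfolded aut_sc_iff]
  show "u \<otimes>\<^bsub>Sym\<^esub> w \<in> carrier (aut_sc S r \<pi>)"
    unfolding aut_sc_iff using u' w' S_arc Bij_imp_funcset[of "vmap w"] Bij_imp_funcset[of "amap w"]
    by (simp add: Sym_mult compose_Bij compose_eq Pi_iff)
next
  fix u assume u: "u \<in> carrier (aut_sc S r \<pi>)"
  note u' = u[unfolded aut_sc_iff]
  let ?v = "inv_into (verts S) (vmap u)" and ?a = "inv_into (arcs S) (amap u)"
  have bij: "bij_betw (vmap u) (verts S) (verts S)" "bij_betw (amap u) (arcs S) (arcs S)"
    using u' Bij_bij_betw by blast+
  have v: "?v x \<in> verts S" "vmap u (?v x) = x" if "x \<in> verts S" for x
    using bij(1) that by (auto simp: bij_betw_def f_inv_into_f inv_into_into)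
  have a: "?a b \<in> arcs S" "amap u (?a b) = b" if "b \<in> arcs S" for b
    using bij(2) that by (auto simp: bij_betw_def f_inv_into_f inv_into_into)
  have v_eq: "?v x = y" if "y \<in> verts S" "vmap u y = x" for x y
    using bij(1) that by (auto simp: bij_betw_def)
  have a_eq: "?a b = c" if "c \<in> arcs S" "amap u c = b" for b c
    using bij(2) that by (auto simp: bij_betw_def)
  have "origin S (?a b) = ?v (origin S b)" "terminus S (?a b) = ?v (terminus S b)"
    "arev S (?a b) = ?a (arev S b)" if b: "b \<in> arcs S" for b
  proof -
    \<comment> \<open>The equations for the inverse are checked after applying \<open>u\<close>,
      where they become the morphism equations of \<open>u\<close> at \<open>?a b\<close>.\<close>
    have "vmap u (origin S (?a b)) = origin S b" "vmap u (terminus S (?a b)) = terminus S b"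
      "amap u (arev S (?a b)) = arev S b"
      using u' a[OF b] by metis+
    then show "origin S (?a b) = ?v (origin S b)" "terminus S (?a b) = ?v (terminus S b)"
      "arev S (?a b) = ?a (arev S b)"
      using v_eq a_eq S_arc(1-3)[OF a(1)[OF b]] by auto
  qed
  moreover have "(x, y) \<in> r \<longleftrightarrow> (?v x, ?v y) \<in> r" if "x \<in> verts S" "y \<in> verts S" for x y
    using u' v that by metis
  moreover have "vmap \<pi> (vbundle (?v x)) = vmap \<pi> (vbundle x)" if "x \<in> verts S" for x
    using u' v that by metis
  moreover have "amap \<pi> (abundle (?a b)) = amap \<pi> (abundle b)" if "b \<in> arcs S" for b
    using u' a that by metis
  ultimately show "inv\<^bsub>Sym\<^esub> u \<in> carrier (aut_sc S r \<pi>)"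
    unfolding aut_sc_iff using u' S_arc by (simp add: Sym_inv restrict_inv_into_Bij)
qed

lemma aut_sc_eq: "aut_sc S r \<pi> = Sym\<lparr>carrier := carrier (aut_sc S r \<pi>)\<rparr>"
  unfolding aut_sc_def by simp

lemma group_aut_sc: "group (aut_sc S r \<pi>)"
  using subgroup.subgroup_is_group[OF subgroup_aut_sc group_Sym] aut_sc_eq by simp

lemma aut_sc_mult_apply:
  assumes "u \<in> carrier (aut_sc S r \<pi>)" "w \<in> carrier (aut_sc S r \<pi>)" "x \<in> verts S"
  shows "vmap (u \<otimes>\<^bsub>aut_sc S r \<pi>\<^esub> w) x = vmap u (vmap w x)"
proof -
  have "u \<otimes>\<^bsub>aut_sc S r \<pi>\<^esub> w = u \<otimes>\<^bsub>Sym\<^esub> w"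
    by (subst aut_sc_eq) simp
  then show ?thesis
    using assms by (simp add: aut_sc_iff Sym_mult compose_eq)
qed

lemma aut_sc_one_apply: "x \<in> verts S \<Longrightarrow> vmap \<one>\<^bsub>aut_sc S r \<pi>\<^esub> x = x"
  unfolding aut_sc_def by (simp add: BijGroup_simps)

lemma aut_sc_closed: "u \<in> carrier (aut_sc S r \<pi>) \<Longrightarrow> x \<in> verts S \<Longrightarrow> vmap u x \<in> verts S"
  using Bij_imp_funcset[of "vmap u"] by (simp add: aut_sc_iff Pi_iff)

lemma aut_sc_bundle:
  assumes u: "u \<in> carrier (aut_sc S r \<pi>)" and V: "V \<in> verts T"
  shows "vmap u ` V \<in> verts T" "vmap \<pi> (vmap u ` V) = vmap \<pi> V"
proof -
  obtain x where x: "x \<in> verts S" "V = vbundle x"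
    using V vert_T_iff by blast
  note u' = u[unfolded aut_sc_iff]
  have "vmap u ` vbundle x = vbundle (vmap u x)"
  proof
    show "vmap u ` vbundle x \<subseteq> vbundle (vmap u x)"
    proof (rule image_subsetI)
      fix y assume "y \<in> vbundle x"
      then have "(vmap u x, vmap u y) \<in> r"
        using u' r_verts by blast
      then show "vmap u y \<in> vbundle (vmap u x)" by blast
    qed
    show "vbundle (vmap u x) \<subseteq> vmap u ` vbundle x"
    proof
      fix y assume y: "y \<in> vbundle (vmap u x)"
      then obtain z where z: "z \<in> verts S" "y = vmap u z"
        using u' r_verts Bij_bij_betw by (metis Image_singleton_iff bij_betw_imp_surj_on imageE)
      then have "(x, z) \<in> r"
        using u' x(1) y by blast
      then show "y \<in> vmap u ` vbundle x"
        using z by blast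
    qed
  qed
  moreover have "vbundle (vmap u x) \<in> verts T"
    using aut_sc_closed[OF u x(1)] vert_T_iff by blast
  moreover have "vmap \<pi> (vbundle (vmap u x)) = vmap \<pi> (vbundle x)"
    using u' x(1) by blast
  ultimately show "vmap u ` V \<in> verts T" "vmap \<pi> (vmap u ` V) = vmap \<pi> V"
    using x(2) by simp_all
qed

text \<open>Comparing a colouring at the image with another colouring at the source makes the
  automorphisms with local actions in the vertex groups the arrows of a groupoid on the colourings.\<close>

definition locally_in ::
  "('sv \<Rightarrow> 'x) \<times> ('sa \<Rightarrow> 'y) \<Rightarrow> ('sv \<Rightarrow> 'x) \<times> ('sa \<Rightarrow> 'y) \<Rightarrow> ('sv \<Rightarrow> 'sv) \<times> ('sa \<Rightarrow> 'sa) \<Rightarrow> bool" where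
  "locally_in q q' u \<longleftrightarrow>
     (\<forall>V\<in>verts T. \<exists>\<sigma>\<in>Grp (vmap \<pi> V). \<forall>x\<in>V. vmap q (vmap u x) = \<sigma> (vmap q' x))"

lemma legal_colour: "legal q \<Longrightarrow> V \<in> verts T \<Longrightarrow> x \<in> V \<Longrightarrow> vmap q x \<in> X (vmap \<pi> V)"
  using legal_bij(1) bij_betwE by blast

lemma locally_in_one:
  assumes "legal q"
  shows "locally_in q q \<one>\<^bsub>aut_sc S r \<pi>\<^esub>"
  unfolding locally_in_def
proof
  fix V assume V: "V \<in> verts T"
  show "\<exists>\<sigma>\<in>Grp (vmap \<pi> V). \<forall>x\<in>V. vmap q (vmap \<one>\<^bsub>aut_sc S r \<pi>\<^esub> x) = \<sigma> (vmap q x)"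
    using perms_one[OF vact_\<pi>[OF V]]
  proof (rule rev_bexI, intro ballI)
    fix x assume "x \<in> V"
    then show "vmap q (vmap \<one>\<^bsub>aut_sc S r \<pi>\<^esub> x) = (\<lambda>x\<in>X (vmap \<pi> V). x) (vmap q x)"
      using legal_colour[OF assms V] vert_T_bundle[OF V] aut_sc_one_apply by simp
  qed
qed

lemma locally_in_mult:
  assumes q: "legal q''" and u: "u \<in> carrier (aut_sc S r \<pi>)" "locally_in q q' u"
    and w: "w \<in> carrier (aut_sc S r \<pi>)" "locally_in q' q'' w"
  shows "locally_in q q'' (u \<otimes>\<^bsub>aut_sc S r \<pi>\<^esub> w)"
  unfolding locally_in_def
proof
  fix V assume V: "V \<in> verts T"
  obtain \<tau> where \<tau>: "\<tau> \<in> Grp (vmap \<pi> V)" "\<forall>x\<in>V. vmap q' (vmap w x) = \<tau> (vmap q'' x)"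
    using w(2) V unfolding locally_in_def by blast
  \<comment> \<open>\<sigma> belongs to the image of \<open>V\<close> under \<open>w\<close>, whose
    vertex group is that of \<open>V\<close> because automorphisms respect \<pi>.\<close>
  obtain \<sigma> where \<sigma>: "\<sigma> \<in> Grp (vmap \<pi> V)" "\<forall>x\<in>vmap w ` V. vmap q (vmap u x) = \<sigma> (vmap q' x)"
    using u(2) aut_sc_bundle[OF w(1) V] unfolding locally_in_def by metis
  show "\<exists>\<sigma>\<in>Grp (vmap \<pi> V). \<forall>x\<in>V. vmap q (vmap (u \<otimes>\<^bsub>aut_sc S r \<pi>\<^esub> w) x) = \<sigma> (vmap q'' x)"
    using perms_compose[OF vact_\<pi>[OF V] \<sigma>(1) \<tau>(1)]
  proof (rule rev_bexI, intro ballI)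
    fix x assume x: "x \<in> V"
    then show "vmap q (vmap (u \<otimes>\<^bsub>aut_sc S r \<pi>\<^esub> w) x) = compose (X (vmap \<pi> V)) \<sigma> \<tau> (vmap q'' x)"
      using \<sigma>(2) \<tau>(2) vert_T_bundle[OF V x] aut_sc_mult_apply[OF u(1) w(1)] legal_colour[OF q V x]
      by (simp add: compose_eq)
  qed
qed

lemma locally_in_inv:
  assumes q: "legal q'" and u: "u \<in> carrier (aut_sc S r \<pi>)" "locally_in q q' u"
  shows "locally_in q' q (inv\<^bsub>aut_sc S r \<pi>\<^esub> u)"
  unfolding locally_in_def
proof
  interpret group "aut_sc S r \<pi>" by (rule group_aut_sc)
  let ?i = "inv\<^bsub>aut_sc S r \<pi>\<^esub> u"
  have i: "?i \<in> carrier (aut_sc S r \<pi>)"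
    using u(1) by simp
  have ui: "vmap u (vmap ?i x) = x" if "x \<in> verts S" for x
    using aut_sc_mult_apply[OF u(1) i that] aut_sc_one_apply[OF that] r_inv[OF u(1)] by simp
  fix V assume V: "V \<in> verts T"
  note V' = aut_sc_bundle[OF i V]
  obtain \<sigma> where \<sigma>: "\<sigma> \<in> Grp (vmap \<pi> V)" "\<forall>x\<in>vmap ?i ` V. vmap q (vmap u x) = \<sigma> (vmap q' x)"
    using u(2) V' unfolding locally_in_def by metis
  obtain l where l: "l \<in> Grp (vmap \<pi> V)" "\<And>x. x \<in> X (vmap \<pi> V) \<Longrightarrow> l (\<sigma> x) = x"
    using perms_inverse[OF vact_\<pi>[OF V] \<sigma>(1)] by blast
  show "\<exists>\<sigma>\<in>Grp (vmap \<pi> V). \<forall>x\<in>V. vmap q' (vmap ?i x) = \<sigma> (vmap q x)"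
    using l(1)
  proof (rule rev_bexI, intro ballI)
    fix x assume x: "x \<in> V"
    have "vmap q x = \<sigma> (vmap q' (vmap ?i x))"
      using \<sigma>(2) x ui vert_T_bundle[OF V x] by (metis imageI)
    moreover have "vmap q' (vmap ?i x) \<in> X (vmap \<pi> V)"
      using legal_colour[OF q V'(1)] x V'(2) by simp
    ultimately show "vmap q' (vmap ?i x) = l (vmap q x)"
      using l(2) by simp
  qed
qed

text \<open>Bijectivity of \<open>q\<close> on \<open>V\<close> and on its image gives existence and
  uniqueness of the described permutation. Membership thus becomes a pointwise condition, a form
  that also makes sense for two different colourings.\<close>

lemma local_action_mem_iff:
  assumes q: "legal q" and u: "u \<in> carrier (aut_sc S r \<pi>)" and V: "V \<in> verts T"
  shows "local_action \<G> \<pi> q u V \<in> Grp (vmap \<pi> V) \<longleftrightarrow>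
    (\<exists>\<sigma>\<in>Grp (vmap \<pi> V). \<forall>x\<in>V. vmap q (vmap u x) = \<sigma> (vmap q x))"
proof -
  let ?X = "X (vmap \<pi> V)" and ?L = "local_action \<G> \<pi> q u V"
  have bq: "bij_betw (vmap q) V ?X"
    using legal_bij(1)[OF q V] .
  have bq': "bij_betw (vmap q) (vmap u ` V) ?X"
    using legal_bij(1)[OF q aut_sc_bundle(1)[OF u V]] aut_sc_bundle(2)[OF u V] by simp
  have "inj_on (vmap u) V"
    using u V vert_T_bundle Bij_bij_betw unfolding aut_sc_iff
    by (meson bij_betw_imp_inj_on inj_on_subset subsetI)
  then have bu: "bij_betw (vmap u) V (vmap u ` V)"
    by (simp add: bij_betw_def)
  let ?\<sigma> = "restrict (vmap q \<circ> (vmap u \<circ> inv_into V (vmap q))) ?X"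
  have \<sigma>: "?\<sigma> \<in> Bij ?X" "\<forall>x\<in>V. ?\<sigma> (vmap q x) = vmap q (vmap u x)"
  proof -
    have "bij_betw (vmap q \<circ> (vmap u \<circ> inv_into V (vmap q))) ?X ?X"
      by (rule bij_betw_trans[OF bij_betw_trans[OF bij_betw_inv_into[OF bq] bu] bq'])
    then show "?\<sigma> \<in> Bij ?X"
      by (simp add: Bij_def)
    show "\<forall>x\<in>V. ?\<sigma> (vmap q x) = vmap q (vmap u x)"
      using bq by (auto simp: bij_betw_def)
  qed
  have unique: "\<sigma> = \<tau>" if "\<sigma> \<in> Bij ?X" "\<tau> \<in> Bij ?X"
    "\<forall>x\<in>V. \<sigma> (vmap q x) = vmap q (vmap u x)" "\<forall>x\<in>V. \<tau> (vmap q x) = vmap q (vmap u x)" for \<sigma> \<tau>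
  proof (rule extensionalityI[OF Bij_imp_extensional Bij_imp_extensional])
    fix y assume "y \<in> ?X"
    then obtain x where "x \<in> V" "y = vmap q x"
      using bq by (auto simp: bij_betw_def)
    then show "\<sigma> y = \<tau> y"
      using that(3,4) by simp
  qed (fact that)+
  have ex1: "\<exists>!\<sigma>. \<sigma> \<in> carrier (BijGroup ?X) \<and> (\<forall>x\<in>V. \<sigma> (vmap q x) = vmap q (vmap u x))"
    unfolding BijGroup_simps using \<sigma> unique by blast
  have L: "?L \<in> Bij ?X" "\<forall>x\<in>V. ?L (vmap q x) = vmap q (vmap u x)"
    using theI'[OF ex1] unfolding local_action_def BijGroup_simps by blast+
  show ?thesis
  proof
    show "\<exists>\<sigma>\<in>Grp (vmap \<pi> V). \<forall>x\<in>V. vmap q (vmap u x) = \<sigma> (vmap q x)" if "?L \<in> Grp (vmap \<pi> V)"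
      by (rule bexI[OF _ that]) (simp add: L(2))
  next
    assume "\<exists>\<sigma>\<in>Grp (vmap \<pi> V). \<forall>x\<in>V. vmap q (vmap u x) = \<sigma> (vmap q x)"
    then obtain \<tau> where \<tau>: "\<tau> \<in> Grp (vmap \<pi> V)" "\<forall>x\<in>V. vmap q (vmap u x) = \<tau> (vmap q x)"
      by blast
    have "?L = \<tau>"
      using unique[OF L(1) perms_Bij[OF vact_\<pi>[OF V] \<tau>(1)] L(2)] \<tau>(2) by simp
    then show "?L \<in> Grp (vmap \<pi> V)"
      using \<tau>(1) by simp
  qed
qed

lemma local_action_iff:
  assumes "legal q" "u \<in> carrier (aut_sc S r \<pi>)"
  shows "(\<forall>V\<in>verts T. local_action \<G> \<pi> q u V \<in> Grp (vmap \<pi> V)) \<longleftrightarrow> locally_in q q u"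
  unfolding locally_in_def using local_action_mem_iff[OF assms] by simp

lemma universal_group_eq:
  assumes "legal q"
  shows "universal_group \<G> S r \<pi> q =
    (aut_sc S r \<pi>)\<lparr>carrier := {u \<in> carrier (aut_sc S r \<pi>). locally_in q q u}\<rparr>"
proof -
  have "{u \<in> carrier (aut_sc S r \<pi>). \<forall>V\<in>verts T. local_action \<G> \<pi> q u V \<in> Grp (vmap \<pi> V)} =
      {u \<in> carrier (aut_sc S r \<pi>). locally_in q q u}"
    using local_action_iff[OF assms] by blast
  then show ?thesis
    unfolding universal_group_def by simp
qed

lemma subgroup_universal:
  assumes "legal q"
  shows "subgroup {u \<in> carrier (aut_sc S r \<pi>). locally_in q q u} (aut_sc S r \<pi>)"
proof -
  interpret group "aut_sc S r \<pi>" by (rule group_aut_sc)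
  show ?thesis
    by (rule subgroup.intro)
      (auto intro: locally_in_one[OF assms] locally_in_mult[OF assms] locally_in_inv[OF assms])
qed

end

context two_colourings
begin

text \<open>Each arc is sent to the one arc joining the images of its ends. Injectivity,
  surjectivity and compatibility with reversal of this arc map are then all read off from the
  ends.\<close>

lemma locally_in_exists: "\<exists>u\<in>carrier (aut_sc S r \<pi>). locally_in p p' u"
proof -
  obtain g where g: "matching g"
    using matching_exists by blast
  have "\<forall>b\<in>arcs S. \<exists>c. c \<in> arcs S \<and> origin S c = g (origin S b) \<and> terminus S c = g (terminus S b) \<and>
      amap \<pi> (abundle c) = amap \<pi> (abundle b)"
    using matching_arc[OF g] by metis
  then obtain ga where ga: "\<And>b. b \<in> arcs S \<Longrightarrow> ga b \<in> arcs S"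
    "\<And>b. b \<in> arcs S \<Longrightarrow> origin S (ga b) = g (origin S b)"
    "\<And>b. b \<in> arcs S \<Longrightarrow> terminus S (ga b) = g (terminus S b)"
    "\<And>b. b \<in> arcs S \<Longrightarrow> amap \<pi> (abundle (ga b)) = amap \<pi> (abundle b)"
    by metis
  note ends = arc_endpoints_inj[OF p]
  have "inj_on ga (arcs S)"
  proof (rule inj_onI)
    fix b c assume bc: "b \<in> arcs S" "c \<in> arcs S" "ga b = ga c"
    then have "g (origin S b) = g (origin S c)" "g (terminus S b) = g (terminus S c)"
      using ga(2,3) by metis+
    then have "origin S b = origin S c" "terminus S b = terminus S c"
      using matching_bij[OF g] S_arc(1,2) bc by (meson bij_betw_imp_inj_on inj_onD)+
    then show "b = c"
      using ends bc by blast
  qed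
  moreover have "ga ` arcs S = arcs S"
  proof
    show "ga ` arcs S \<subseteq> arcs S"
      using ga(1) by blast
    show "arcs S \<subseteq> ga ` arcs S"
    proof
      fix c assume c: "c \<in> arcs S"
      then have "origin S c \<in> g ` verts S" "terminus S c \<in> g ` verts S"
        using matching_bij[OF g] S_arc(1,2) by (auto simp: bij_betw_def)
      then obtain x y where xy: "x \<in> verts S" "y \<in> verts S" "origin S c = g x" "terminus S c = g y"
        by auto
      then obtain b where b: "b \<in> arcs S" "origin S b = x" "terminus S b = y"
        using matching_arc_over_iff[OF g xy(1,2)] arc_overI[OF c] unfolding arc_over_def by metis
      then have "ga b = c"
        using ends[OF ga(1)[OF b(1)] c] ga(2,3)[OF b(1)] xy by simp
      then show "c \<in> ga ` arcs S"
        using b(1) by blast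
    qed
  qed
  ultimately have ga_bij: "bij_betw ga (arcs S) (arcs S)"
    by (simp add: bij_betw_def)
  have ga_rev: "arev S (ga b) = ga (arev S b)" if "b \<in> arcs S" for b
    using ends[OF S_arc(3)[OF ga(1)[OF that]] ga(1)[OF S_arc(3)[OF that]]] that
    by (simp add: S_arc ga)
  \<comment> \<open>Elements of \<open>BijGroup\<close> are extensional, hence the
    restrictions.\<close>
  let ?u = "(restrict g (verts S), restrict ga (arcs S))"
  have "vmap \<pi> (vbundle (g x)) = vmap \<pi> (vbundle x)" if "x \<in> verts S" for x
    using matching_vbundle(2)[OF g that] matching_vert(2)[OF g] that vert_T_iff by metis
  then have "?u \<in> carrier (aut_sc S r \<pi>)"
    unfolding aut_sc_iff using matching_bij[OF g] ga_bij ga ga_rev S_arc matching_vbundle_eq_iff[OF g]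
    by (simp add: Bij_def)
  moreover have "locally_in p p' ?u"
    unfolding locally_in_def
  proof
    fix V assume V: "V \<in> verts T"
    then have "V \<subseteq> verts S"
      using vert_T_bundle by blast
    then show "\<exists>\<sigma>\<in>Grp (vmap \<pi> V). \<forall>x\<in>V. vmap p (vmap ?u x) = \<sigma> (vmap p' x)"
      using matching_local[OF g V] unfolding local_match_def by (simp add: subset_iff)
  qed
  ultimately show ?thesis
    by blast
qed

end

section \<open>Conjugation\<close>

lemma (in group) subgroup_conjugate:
  assumes H: "subgroup H G" and g: "g \<in> carrier G"
  shows "subgroup (g <# H #> inv g) G"
proof -
  have HG: "h \<in> carrier G" if "h \<in> H" for h
    using H that subgroup.mem_carrier by fast
  have cancel: "inv g \<otimes> (g \<otimes> x) = x" if "x \<in> carrier G" for x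
    using g that by (simp flip: m_assoc)
  have coset: "g <# H #> inv g = (\<lambda>h. g \<otimes> h \<otimes> inv g) ` H"
    unfolding l_coset_def r_coset_def by auto
  show ?thesis
    unfolding coset
  proof (rule subgroupI)
    show "(\<lambda>h. g \<otimes> h \<otimes> inv g) ` H \<subseteq> carrier G"
      using HG g by auto
    show "(\<lambda>h. g \<otimes> h \<otimes> inv g) ` H \<noteq> {}"
      using subgroup.one_closed[OF H] by blast
  next
    fix a assume "a \<in> (\<lambda>h. g \<otimes> h \<otimes> inv g) ` H"
    then obtain h where h: "h \<in> H" "a = g \<otimes> h \<otimes> inv g" by blast
    then have "inv a = g \<otimes> inv h \<otimes> inv g"
      using HG g by (simp add: inv_mult_group m_assoc)
    then show "inv a \<in> (\<lambda>h. g \<otimes> h \<otimes> inv g) ` H"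
      using subgroup.m_inv_closed[OF H h(1)] by blast
  next
    fix a b assume "a \<in> (\<lambda>h. g \<otimes> h \<otimes> inv g) ` H" "b \<in> (\<lambda>h. g \<otimes> h \<otimes> inv g) ` H"
    then obtain h k where h: "h \<in> H" "a = g \<otimes> h \<otimes> inv g" and k: "k \<in> H" "b = g \<otimes> k \<otimes> inv g" by blast
    then have "a \<otimes> b = g \<otimes> (h \<otimes> k) \<otimes> inv g"
      using HG g by (simp add: m_assoc cancel)
    then show "a \<otimes> b \<in> (\<lambda>h. g \<otimes> h \<otimes> inv g) ` H"
      using subgroup.m_closed[OF H h(1) k(1)] by blast
  qed
qed

lemma (in group) conjugate_inverse:
  assumes H: "H \<subseteq> carrier G" and g: "g \<in> carrier G"
  shows "inv g <# (g <# H #> inv g) #> inv (inv g) = H"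
proof -
  have "inv g <# (g <# H #> inv g) #> inv (inv g) = (\<lambda>h. inv g \<otimes> (g \<otimes> h \<otimes> inv g) \<otimes> inv (inv g)) ` H"
    unfolding l_coset_def r_coset_def by auto
  also have "\<dots> = (\<lambda>h. h) ` H"
  proof (rule image_cong[OF refl])
    fix h assume "h \<in> H"
    then have h: "h \<in> carrier G" using H by blast
    have "inv g \<otimes> (g \<otimes> h) = h"
      using g h by (simp flip: m_assoc)
    then show "inv g \<otimes> (g \<otimes> h \<otimes> inv g) \<otimes> inv (inv g) = h"
      using g h by (simp add: m_assoc)
  qed
  finally show ?thesis
    by simp
qed

theorem theorem6p2:
  fixes \<G> :: "('v, 'a, 'g, 'x, 'h, 'y) gga"
    and S :: "('sv, 'sa) rgraph"
    and r :: "('sv \<times> 'sv) set"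
    and \<pi> :: "('sv set \<Rightarrow> 'v) \<times> ('sa set \<Rightarrow> 'a)"
    and p\<^sub>0 p :: "('sv \<Rightarrow> 'x) \<times> ('sa \<Rightarrow> 'y)"
    and H :: "(('sv \<Rightarrow> 'sv) \<times> ('sa \<Rightarrow> 'sa)) set"
  assumes "graph_of_group_actions \<G>"
    and "scaffolding \<G> S r \<pi> p\<^sub>0"
    and "legal_colouring \<G> S r \<pi> p"
    and "subgroup H (aut_sc S r \<pi>)"
    and "locally_gga \<G> S r \<pi> H"
  shows "\<exists>K. subgroup K (universal_group \<G> S r \<pi> p) \<and>
             (\<exists>g\<in>carrier (aut_sc S r \<pi>).
                H = g <#\<^bsub>aut_sc S r \<pi>\<^esub> K #>\<^bsub>aut_sc S r \<pi>\<^esub> inv\<^bsub>aut_sc S r \<pi>\<^esub> g)"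
proof -
  let ?A = "aut_sc S r \<pi>"
  obtain p' where p': "legal_colouring \<G> S r \<pi> p'"
    and local: "\<forall>h\<in>H. \<forall>V\<in>verts (quotient_graph S r). local_action \<G> \<pi> p' h V \<in> perms (vact \<G> (vmap \<pi> V))"
    using assms(5) unfolding locally_gga_def by blast
  interpret two_colourings \<G> S r \<pi> p p'
    using assms(1-3) p' by unfold_locales (auto simp: scaffolding_def)
  interpret group ?A by (rule group_aut_sc)
  note H = subgroup.mem_carrier[OF assms(4)]
  obtain g where g: "g \<in> carrier ?A" "locally_in p p' g"
    using locally_in_exists by blast
  \<comment> \<open>\<open>g\<close> leads from \<open>p'\<close> to \<open>p\<close>, an element of
    \<open>H\<close> from \<open>p'\<close> to itself, and the inverse of \<open>g\<close> from
    \<open>p\<close> back to \<open>p'\<close>. The composite compares \<open>p\<close> only with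
    itself.\<close>
  let ?K = "g <#\<^bsub>?A\<^esub> H #>\<^bsub>?A\<^esub> inv\<^bsub>?A\<^esub> g"
  have "locally_in p p (g \<otimes>\<^bsub>?A\<^esub> h \<otimes>\<^bsub>?A\<^esub> inv\<^bsub>?A\<^esub> g)" if h: "h \<in> H" for h
  proof -
    have "locally_in p' p' h"
      using local_action_iff[OF p' H[OF h]] local h by blast
    then have "locally_in p p' (g \<otimes>\<^bsub>?A\<^esub> h)"
      using locally_in_mult[OF p' g] H[OF h] by blast
    then show ?thesis
      using locally_in_mult[OF p _ _ _ locally_in_inv[OF p' g]] g(1) H[OF h] by simp
  qed
  then have "?K \<subseteq> {u \<in> carrier ?A. locally_in p p u}"
    using subgroup.subset[OF subgroup_conjugate[OF assms(4) g(1)]]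
    unfolding l_coset_def r_coset_def by blast
  then have "subgroup ?K (universal_group \<G> S r \<pi> p)"
    unfolding universal_group_eq[OF p]
    by (rule subgroup_incl[OF subgroup_conjugate[OF assms(4) g(1)] subgroup_universal[OF p]])
  \<comment> \<open>\<open>H\<close> has to be written as a conjugate of \<open>?K\<close>, so the
    conjugating element is the inverse of \<open>g\<close>.\<close>
  moreover have "H = inv\<^bsub>?A\<^esub> g <#\<^bsub>?A\<^esub> ?K #>\<^bsub>?A\<^esub> inv\<^bsub>?A\<^esub> (inv\<^bsub>?A\<^esub> g)"
    using conjugate_inverse[OF subgroup.subset[OF assms(4)] g(1)] by simp
  ultimately show ?thesis
    using inv_closed[OF g(1)] by blast
qed

end
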